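(* Let $(H, \|\cdot\|_H, \langle\cdot,\cdot\rangle_H)$ be the $\mathbb{R}$-Hilbert space of equivalence classes of Lebesgue square integrable functions from $(0,1)$ to $\mathbb{R}$, let $A\colon D(A)\subseteq H\to H$ be the Laplacian with periodic boundary conditions on $H$, let $e_n\in H$, $n\in\mathbb{Z}$, satisfy for all $n\in\mathbb{N}$ that $e_0(\cdot)=1$, $e_n(\cdot)=\sqrt{2}\cos(2n\pi(\cdot))$, and $e_{-n}(\cdot)=\sqrt{2}\sin(2n\pi(\cdot))$, let $T,\eta\in(0,\infty)$, let $(H_r,\|\cdot\|_{H_r},\langle\cdot,\cdot\rangle_{H_r})$, $r\in\mathbb{R}$, be a family of interpolation spaces associated to $\eta-A$, let $P_N\colon H\to H$, $N\in\mathbb{N}$, be the linear operators which satisfy for all $N\in\mathbb{N}$, $v\in H$ that $P_N(v)=\sum_{n=-N}^{N}\langle e_n,v\rangle_H\, e_n$, let $(\Omega,\mathcal{F},\mathbb{P})$ be a probability space, let $q\in\{2,3,\dots\}$, $a_0,a_1,\dots,a_{q-1}\in\mathbb{R}$, $a_q\in\mathbb{R}\setminus\{0\}$, $\nu\in(1/4,3/4)$, $\xi\in H_{1/3}$, let $W\colon[0,T]\times\Omega\to H_{-\nu}$ be an $\operatorname{Id}_H$-cylindrical Wiener process, let $S_N\colon H_{-\nu}\to H$, $N\in\mathbb{N}$, be linear operators which satisfy for all $N\in\mathbb{N}$ that $S_N\in\{e^{(T/N)A},(I-(T/N)A)^{-1}\}$, and let $Y^N\colon\{0,1,\dots,N\}\times\Omega\to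 H$, $N\in\mathbb{N}$, be the stochastic processes which satisfy for all $N\in\mathbb{N}$, $n\in\{0,1,\dots,N-1\}$ that $Y^N_0=P_N(\xi)$ and $$Y^N_{n+1}=P_NS_N\Big(Y^N_n+\tfrac{T}{N}\Big(\sum_{k=0}^{q}a_k\,[Y^N_n]^k\Big)+\big(W_{(n+1)T/N}-W_{nT/N}\big)\Big).$$ Then it holds for all $p\in(0,\infty)$ that $\liminf_{N\to\infty}\mathbb{E}\big[\|Y^N_N\|_H^p\big]=\infty$.
   Context: $\mathbb{N}=\{1,2,3,\dots\}$. The Laplacian with periodic boundary conditions is the operator with $D(A)=\{v\in H\colon\sum_{n\in\mathbb{Z}}n^4|\langle e_n,v\rangle_H|^2<\infty\}$ and $Av=\sum_{n\in\mathbb{Z}}-4\pi^2n^2\langle e_n,v\rangle_H e_n$. Interpolation spaces associated to $\eta-A$: for $r\ge0$, $H_r=D((\eta-A)^r)$ with $\langle v,w\rangle_{H_r}=\langle(\eta-A)^rv,(\eta-A)^rw\rangle_H$; for $r<0$, $H_r$ is the completion of $H$ with respect to the norm $\|(\eta-A)^rv\|_H$; in particular $H_0=H$, $H_1=D(A)$, and $H_r\subseteq H_s$ for $r\ge s$. The operators $e^{tA}$ and $(I-tA)^{-1}$, $t>0$ ($I$ is the identity), are understood on $H_{-\nu}$ by continuous extension (they act diagonally on $(e_n)$ with multipliers $e^{-4\pi^2n^2t}$ and $(1+4\pi^2n^2t)^{-1}$ respectively). An $\operatorname{Id}_H$-cylindrical Wiener process is an $H_{-\nu}$-valued process of the form $W_t=\sum_{n\in\mathbb{Z}}\beta^n_te_n$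 (convergence in $H_{-\nu}$) with $\beta^n$, $n\in\mathbb{Z}$, independent standard real Brownian motions. $[v]^k$ denotes the pointwise $k$-th power of a function $v$ (with $[v]^0=1$). *)

theory Defs
  imports "HOL-Probability.Probability"
begin

text \<open>Functions on the open unit interval are represented by functions on the reals whose values outside
  the interval are irrelevant.\<close>

definition sq_integrable :: "(real \<Rightarrow> real) \<Rightarrow> bool" where
  "sq_integrable f \<longleftrightarrow> f \<in> borel_measurable (lebesgue_on {0<..<1}) \<and>
     integrable (lebesgue_on {0<..<1}) (\<lambda>x. (f x)\<^sup>2)"

definition ae_eq :: "(real \<Rightarrow> real) \<Rightarrow> (real \<Rightarrow> real) \<Rightarrow> bool" where
  "ae_eq f g \<longleftrightarrow> sq_integrable f \<and> sq_integrable g \<and> (AE x in lebesgue_on {0<..<1}. f x = g x)"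

lemma sq_integrable_cong_AE:
  assumes "f \<in> borel_measurable (lebesgue_on {0<..<1})" "g \<in> borel_measurable (lebesgue_on {0<..<1})"
    and "AE x in lebesgue_on {0<..<1}. f x = g x"
  shows "sq_integrable f \<longleftrightarrow> sq_integrable g"
proof -
  have "integrable (lebesgue_on {0<..<1}) (\<lambda>x. (f x)\<^sup>2) \<longleftrightarrow>
        integrable (lebesgue_on {0<..<1}) (\<lambda>x. (g x)\<^sup>2)"
    by (rule integrable_cong_AE) (use assms in auto)
  then show ?thesis using assms by (simp add: sq_integrable_def)
qed

lemma sq_integrable_zero: "sq_integrable (\<lambda>_. 0)"
  by (simp add: sq_integrable_def)

lemma sq_integrable_mult:
  assumes "sq_integrable f" "sq_integrable g"
  shows "integrable (lebesgue_on {0<..<1}) (\<lambda>x. f x * g x)"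
proof (rule Bochner_Integration.integrable_bound)
  show "integrable (lebesgue_on {0<..<1}) (\<lambda>x. (f x)\<^sup>2 + (g x)\<^sup>2)"
    using assms by (auto simp: sq_integrable_def)
  show "(\<lambda>x. f x * g x) \<in> borel_measurable (lebesgue_on {0<..<1})"
    using assms by (auto simp: sq_integrable_def)
  have "\<bar>a * b\<bar> \<le> a\<^sup>2 + b\<^sup>2" for a b :: real
  proof -
    have "2 * (\<bar>a\<bar> * \<bar>b\<bar>) \<le> a\<^sup>2 + b\<^sup>2"
      using sum_squares_bound[of "\<bar>a\<bar>" "\<bar>b\<bar>"] by simp
    moreover have "0 \<le> \<bar>a\<bar> * \<bar>b\<bar>" by simp
    ultimately show ?thesis unfolding abs_mult by linarith
  qed
  then show "AE x in lebesgue_on {0<..<1}. norm (f x * g x) \<le> norm ((f x)\<^sup>2 + (g x)\<^sup>2)"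
    by auto
qed

lemma sq_integrable_add:
  assumes "sq_integrable f" "sq_integrable g"
  shows "sq_integrable (\<lambda>x. f x + g x)"
proof -
  have "integrable (lebesgue_on {0<..<1}) (\<lambda>x. (f x)\<^sup>2 + (g x)\<^sup>2 + 2 * (f x * g x))"
    using assms sq_integrable_mult[OF assms] by (auto simp: sq_integrable_def)
  then show ?thesis
    using assms by (auto simp: sq_integrable_def power2_sum mult.assoc)
qed

lemma sq_integrable_scale:
  assumes "sq_integrable f"
  shows "sq_integrable (\<lambda>x. c * f x)"
  using assms by (auto simp: sq_integrable_def power_mult_distrib)

lemma sq_integrable_uminus:
  assumes "sq_integrable f"
  shows "sq_integrable (\<lambda>x. - f x)"
  using sq_integrable_scale[OF assms, of "-1"] by simp

lemma sq_integrable_diff: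
  assumes "sq_integrable f" "sq_integrable g"
  shows "sq_integrable (\<lambda>x. f x - g x)"
  using sq_integrable_add[OF assms(1) sq_integrable_uminus[OF assms(2)]] by simp

lemma sq_integrable_continuous_bounded:
  assumes "continuous_on UNIV f" "\<And>x. \<bar>f x\<bar> \<le> B"
  shows "sq_integrable f"
proof -
  have 1: "f \<in> borel_measurable (lebesgue_on {0<..<1})"
    using assms(1) borel_measurable_continuous_onI by (intro measurable_restrict_space1 measurable_completion) auto
  have "finite_measure (lebesgue_on {0<..<1::real})"
    by (rule finite_measureI) (simp add: emeasure_restrict_space)
  then have "integrable (lebesgue_on {0<..<1}) (\<lambda>x. (f x)\<^sup>2)"
    using 1 assms(2) power2_le_iff_abs_le[of B] order_trans[OF abs_ge_zero assms(2)]
    by (intro finite_measure.integrable_const_bound[where B = "B\<^sup>2"])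
       (auto simp: abs_le_square_iff[symmetric])
  then show ?thesis using 1 by (simp add: sq_integrable_def)
qed

quotient_type l2 = "real \<Rightarrow> real" / partial: ae_eq
proof (rule part_equivpI)
  show "\<exists>x. ae_eq x x"
    using sq_integrable_zero by (auto simp: ae_eq_def)
  show "symp ae_eq"
    by (auto simp: symp_def ae_eq_def)
  show "transp ae_eq"
    unfolding transp_def ae_eq_def by (auto elim: AE_mp)
qed

instantiation l2 :: real_vector
begin

lift_definition zero_l2 :: l2 is "\<lambda>_. 0"
  by (simp add: ae_eq_def sq_integrable_zero)

lift_definition plus_l2 :: "l2 \<Rightarrow> l2 \<Rightarrow> l2" is "\<lambda>f g x. f x + g x"
  unfolding ae_eq_def by (auto intro: sq_integrable_add)

lift_definition uminus_l2 :: "l2 \<Rightarrow> l2" is "\<lambda>f x. - f x"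
  unfolding ae_eq_def by (auto intro: sq_integrable_uminus)

lift_definition minus_l2 :: "l2 \<Rightarrow> l2 \<Rightarrow> l2" is "\<lambda>f g x. f x - g x"
  unfolding ae_eq_def by (auto intro: sq_integrable_diff)

lift_definition scaleR_l2 :: "real \<Rightarrow> l2 \<Rightarrow> l2" is "\<lambda>c f x. c * f x"
  unfolding ae_eq_def by (auto intro: sq_integrable_scale)

instance
proof
  fix u v w :: l2 and b c :: real
  show "u + v + w = u + (v + w)"
    by transfer (auto simp: ae_eq_def add.assoc intro: sq_integrable_add)
  show "u + v = v + u"
    by transfer (auto simp: ae_eq_def add.commute intro: sq_integrable_add)
  show "0 + u = u"
    by transfer (auto simp: ae_eq_def)
  show "- u + u = 0"
    by transfer (auto simp: ae_eq_def sq_integrable_zero)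
  show "u - v = u + - v"
    by transfer (auto simp: ae_eq_def intro: sq_integrable_diff)
  show "b *\<^sub>R (u + v) = b *\<^sub>R u + b *\<^sub>R v"
    by transfer (auto simp: ae_eq_def distrib_left intro!: sq_integrable_scale sq_integrable_add)
  show "(b + c) *\<^sub>R u = b *\<^sub>R u + c *\<^sub>R u"
    by transfer (auto simp: ae_eq_def distrib_right intro!: sq_integrable_scale sq_integrable_add)
  show "b *\<^sub>R c *\<^sub>R u = (b * c) *\<^sub>R u"
    by transfer (auto simp: ae_eq_def mult.assoc intro!: sq_integrable_scale)
  show "1 *\<^sub>R u = u"
    by transfer (auto simp: ae_eq_def)
qed

end

instantiation l2 :: real_inner
begin

lift_definition inner_l2 :: "l2 \<Rightarrow> l2 \<Rightarrow> real"
  is "\<lambda>f g. LINT x|lebesgue_on {0<..<1}. f x * g x"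
  unfolding ae_eq_def sq_integrable_def by (rule integral_cong_AE) auto

definition norm_l2 :: "l2 \<Rightarrow> real" where "norm_l2 v = sqrt (inner v v)"
definition dist_l2 :: "l2 \<Rightarrow> l2 \<Rightarrow> real" where "dist_l2 v w = norm (v - w)"
definition sgn_l2 :: "l2 \<Rightarrow> l2" where "sgn_l2 v = v /\<^sub>R norm v"
definition uniformity_l2 :: "(l2 \<times> l2) filter" where
  "uniformity_l2 = (INF e\<in>{0 <..}. principal {(v, w). dist v w < e})"
definition open_l2 :: "l2 set \<Rightarrow> bool" where
  "open_l2 U = (\<forall>v\<in>U. eventually (\<lambda>(v', w). v' = v \<longrightarrow> w \<in> U) uniformity)"

instance
proof
  fix u v w :: l2 and b :: real
  show "inner u v = inner v u"
    by transfer (simp add: mult.commute)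
  show "inner (u + v) w = inner u w + inner v w"
    by transfer (auto simp: ae_eq_def distrib_right sq_integrable_mult)
  show "inner (b *\<^sub>R u) v = b * inner u v"
    by transfer (simp add: mult.assoc)
  show "0 \<le> inner u u"
    by transfer simp
  show "inner u u = 0 \<longleftrightarrow> u = 0"
    by transfer (auto simp: ae_eq_def sq_integrable_zero sq_integrable_mult integral_nonneg_eq_0_iff_AE)
qed (rule norm_l2_def dist_l2_def sgn_l2_def uniformity_l2_def open_l2_def)+

end

text \<open>The class of the pointwise power, whenever this is again square integrable (for instance if
  the class has a bounded representative, as every trigonometric polynomial does); otherwise zero.\<close>

lift_definition l2_power :: "l2 \<Rightarrow> nat \<Rightarrow> l2"
  is "\<lambda>f k. if sq_integrable (\<lambda>x. f x ^ k) then (\<lambda>x. f x ^ k) else (\<lambda>_. 0)"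
proof -
  fix f g :: "real \<Rightarrow> real" and k
  assume fg: "ae_eq f g"
  then have "sq_integrable (\<lambda>x. f x ^ k) \<longleftrightarrow> sq_integrable (\<lambda>x. g x ^ k)"
    by (intro sq_integrable_cong_AE) (auto simp: ae_eq_def sq_integrable_def)
  then show "ae_eq (if sq_integrable (\<lambda>x. f x ^ k) then \<lambda>x. f x ^ k else (\<lambda>_. 0))
                   (if sq_integrable (\<lambda>x. g x ^ k) then \<lambda>x. g x ^ k else (\<lambda>_. 0))"
    using fg by (auto simp: ae_eq_def sq_integrable_zero)
qed

lift_definition ebasis :: "int \<Rightarrow> l2"
  is "\<lambda>n x. if n = 0 then 1
            else if n > 0 then sqrt 2 * cos (2 * of_int n * pi * x)
            else sqrt 2 * sin (2 * of_int (- n) * pi * x)"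
proof -
  fix n :: int
  have *: "sq_integrable (\<lambda>x. if n = 0 then 1
            else if n > 0 then sqrt 2 * cos (2 * of_int n * pi * x)
            else sqrt 2 * sin (2 * of_int (- n) * pi * x))"
    by (rule sq_integrable_continuous_bounded[where B = "sqrt 2"])
       (cases "n = 0"; cases "n > 0";
        auto intro!: continuous_intros simp: abs_mult mult_le_cancel_left1)+
  show "ae_eq (\<lambda>x. if n = 0 then 1
            else if n > 0 then sqrt 2 * cos (2 * of_int n * pi * x)
            else sqrt 2 * sin (2 * of_int (- n) * pi * x))
         (\<lambda>x. if n = 0 then 1
            else if n > 0 then sqrt 2 * cos (2 * of_int n * pi * x)
            else sqrt 2 * sin (2 * of_int (- n) * pi * x))"
    using * by (simp add: ae_eq_def)
qed

text \<open>The Laplacian is meaningful on \<open>lap_dom\<close> only; \<open>heat t\<close> is the semigroup it generates, and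
  \<open>resolvent t\<close> is the inverse of \<open>I - t A : D(A) \<rightarrow> H\<close>.\<close>

definition lap_dom :: "l2 set" where
  "lap_dom = {v. (\<lambda>n. of_int n ^ 4 * (inner (ebasis n) v)\<^sup>2) summable_on UNIV}"

definition lap :: "l2 \<Rightarrow> l2" where
  "lap v = (\<Sum>\<^sub>\<infinity>n\<in>UNIV. (- 4 * pi\<^sup>2 * (of_int n)\<^sup>2 * inner (ebasis n) v) *\<^sub>R ebasis n)"

definition heat :: "real \<Rightarrow> l2 \<Rightarrow> l2" where
  "heat t v = (\<Sum>\<^sub>\<infinity>n\<in>UNIV. (exp (- 4 * pi\<^sup>2 * (of_int n)\<^sup>2 * t) * inner (ebasis n) v) *\<^sub>R ebasis n)"

definition resolvent :: "real \<Rightarrow> l2 \<Rightarrow> l2" where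
  "resolvent t = inv_into lap_dom (\<lambda>u. u - t *\<^sub>R lap u)"

text \<open>Fractional powers of the positive diagonal operator \<open>\<eta> - A\<close>, where \<open>A\<close> is \<^const>\<open>lap\<close>.\<close>

definition frac_dom :: "real \<Rightarrow> real \<Rightarrow> l2 set" where
  "frac_dom \<eta> r =
     {v. (\<lambda>n. (((\<eta> + 4 * pi\<^sup>2 * (of_int n)\<^sup>2) powr r) * inner (ebasis n) v)\<^sup>2) summable_on UNIV}"

definition frac_pow :: "real \<Rightarrow> real \<Rightarrow> l2 \<Rightarrow> l2" where
  "frac_pow \<eta> r v =
     (\<Sum>\<^sub>\<infinity>n\<in>UNIV. ((\<eta> + 4 * pi\<^sup>2 * (of_int n)\<^sup>2) powr r * inner (ebasis n) v) *\<^sub>R ebasis n)"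

text \<open>For \<open>r \<ge> 0\<close> the interpolation space of order \<open>r\<close> is the set \<^term>\<open>frac_dom \<eta> r\<close>.
  For \<open>r < 0\<close> it is a completion of \<^typ>\<open>l2\<close>, hence given only up to isometry: any complete inner
  product space \<open>'b\<close> together with a linear embedding \<open>\<iota>\<close> of \<^typ>\<open>l2\<close> that has dense range and is
  isometric for the norm of order \<open>r\<close>. The embedding is the inclusion of \<^typ>\<open>l2\<close> into it.\<close>

definition neg_interpolation_space ::
    "real \<Rightarrow> real \<Rightarrow> (l2 \<Rightarrow> 'b::{real_inner,banach}) \<Rightarrow> bool" where
  "neg_interpolation_space \<eta> r \<iota> \<longleftrightarrow>
     linear \<iota> \<and> (\<forall>v. norm (\<iota> v) = norm (frac_pow \<eta> r v)) \<and> closure (range \<iota>) = UNIV"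

text \<open>Since \<open>\<iota>\<close> has dense range, there is at most one continuous extension.\<close>

definition continuous_extension ::
    "(l2 \<Rightarrow> 'b::{real_inner,banach}) \<Rightarrow> (l2 \<Rightarrow> l2) \<Rightarrow> ('b \<Rightarrow> l2) \<Rightarrow> bool" where
  "continuous_extension \<iota> F S \<longleftrightarrow> bounded_linear S \<and> (\<forall>v. S (\<iota> v) = F v)"

definition proj :: "nat \<Rightarrow> l2 \<Rightarrow> l2" where
  "proj N v = (\<Sum>n\<in>{- int N..int N}. inner (ebasis n) v *\<^sub>R ebasis n)"

definition brownian_motion :: "'w measure \<Rightarrow> real \<Rightarrow> (real \<Rightarrow> 'w \<Rightarrow> real) \<Rightarrow> bool" where
  "brownian_motion M T B \<longleftrightarrow>
     (\<forall>t\<in>{0..T}. B t \<in> borel_measurable M) \<and>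
     (AE \<omega> in M. B 0 \<omega> = 0) \<and>
     (\<forall>(m::nat) (t::nat \<Rightarrow> real). 0 \<le> t 0 \<and> (\<forall>i<m. t i \<le> t (Suc i)) \<and> t m \<le> T \<longrightarrow>
        prob_space.indep_vars M (\<lambda>_. borel) (\<lambda>i \<omega>. B (t (Suc i)) \<omega> - B (t i) \<omega>) {..<m}) \<and>
     (\<forall>s t. 0 \<le> s \<and> s < t \<and> t \<le> T \<longrightarrow>
        distributed M lborel (\<lambda>\<omega>. B t \<omega> - B s \<omega>) (normal_density 0 (sqrt (t - s)))) \<and>
     (AE \<omega> in M. continuous_on {0..T} (\<lambda>t. B t \<omega>))"

text \<open>Independence of the Brownian motions is independence as random elements of the product space
  over the time interval. The series converges almost surely at every fixed time.\<close>

definition cylindrical_wiener ::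
    "'w measure \<Rightarrow> real \<Rightarrow> (l2 \<Rightarrow> 'b::{real_inner,banach}) \<Rightarrow> (real \<Rightarrow> 'w \<Rightarrow> 'b) \<Rightarrow> bool" where
  "cylindrical_wiener M T \<iota> W \<longleftrightarrow>
     (\<forall>t\<in>{0..T}. W t \<in> borel_measurable M) \<and>
     (\<exists>\<beta> :: int \<Rightarrow> real \<Rightarrow> 'w \<Rightarrow> real.
        (\<forall>n. brownian_motion M T (\<beta> n)) \<and>
        prob_space.indep_vars M (\<lambda>_. Pi\<^sub>M {0..T} (\<lambda>_. borel)) (\<lambda>n \<omega>. \<lambda>t\<in>{0..T}. \<beta> n t \<omega>) UNIV \<and>
        (\<forall>t\<in>{0..T}. AE \<omega> in M. ((\<lambda>n. \<beta> n t \<omega> *\<^sub>R \<iota> (ebasis n)) has_sum W t \<omega>) UNIV))"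

end

theory Submission
  imports Defs "HOL-Real_Asymp.Real_Asymp"
begin

text \<open>
  Why the moments diverge: one step of the scheme replaces a large, nearly constant state of height
  \<open>c\<close> by one of height about \<open>(T / N) * a q * c ^ q\<close>. Once \<open>c\<close> exceeds a threshold of order \<open>N\<close>
  the height is therefore at least squared in every step, up to a factor of order \<open>1 / N\<close>, and after
  \<open>N\<close> steps it is at least of order \<open>4 ^ 2 ^ (N - 1)\<close>. The probability that the noise produces such
  a path is only exponentially small in a power of \<open>N\<close>, so the product of this probability with the
  \<open>p\<close>-th power of the height still tends to infinity.

  If \<open>q\<close> is even, Jensen's inequality turns the spatial mean of the solution into a closed scalar
  recursion. This fails for odd \<open>q\<close>, and the other Fourier modes then have to be controlled. They are
  controlled here by restricting the noise: its first increment is required to steer the state to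
  within a tolerance \<open>\<epsilon>\<close> of a large constant function, and all later increments of
  the \<open>2 * N + 1\<close> relevant modes are required to be at most \<open>\<epsilon>\<close>. The ratio of the other modes to the
  mean grows at most by a factor \<open>G\<close> of order \<open>N\<close> in each step (\<open>cone_step\<close>), hence \<open>\<epsilon>\<close> of order
  \<open>1 / (N * G ^ N)\<close> keeps this ratio small up to time \<open>N\<close>, and the mean alone determines the growth
  (\<open>doubly_exponential_growth\<close>). The increments of the modes are independent Gaussian variables and
  the shift needed for the steering is polynomially bounded in \<open>N\<close>, so the event has
  probability at least \<open>exp (- Q N)\<close> with \<open>Q\<close> polynomially bounded
  (\<open>prob_independent_brownian_boxes_ge\<close>, \<open>exp_minus_cost_le\<close>, \<open>poly_bounded_cost\<close>).

  What remains is the passage from the equation in the Hilbert space to its Fourier coefficients.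
  Since the state is a trigonometric polynomial, so is its image under the nonlinearity, and on
  trigonometric polynomials and on the noise series both choices of \<open>S\<close> are diagonal with
  multipliers in the unit interval and multiplier \<open>1\<close> on constants (\<open>coefficient_recursion\<close>).
\<close>

section \<open>The Fourier basis and trigonometric polynomials\<close>

text \<open>The representative of \<^const>\<open>ebasis\<close> that is continuous and defined on all of the
  real line; pointwise bounds on trigonometric polynomials refer to it.\<close>

definition fourier_fun :: "int \<Rightarrow> real \<Rightarrow> real" where
  "fourier_fun n x = (if n = 0 then 1
     else if n > 0 then sqrt 2 * cos (2 * of_int n * pi * x)
     else sqrt 2 * sin (2 * of_int (- n) * pi * x))"

lemma sqrt2_le_2: "sqrt 2 \<le> 2"
  by (rule real_le_lsqrt) auto

lemma abs_fourier_fun_le: "\<bar>fourier_fun n x\<bar> \<le> 2"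
proof -
  have "\<bar>sqrt 2 * y\<bar> \<le> 2" if "\<bar>y\<bar> \<le> 1" for y :: real
    using mult_mono[OF sqrt2_le_2 that] by (simp add: abs_mult)
  then show ?thesis by (simp add: fourier_fun_def)
qed

lemma continuous_on_fourier_fun: "continuous_on UNIV (fourier_fun n)"
  unfolding fourier_fun_def
  by (cases "n = 0"; cases "n > 0") (auto intro!: continuous_intros)

lemma sq_integrable_fourier_fun: "sq_integrable (fourier_fun n)"
  by (rule sq_integrable_continuous_bounded[OF continuous_on_fourier_fun abs_fourier_fun_le])

lemma ebasis_eq_abs: "ebasis n = abs_l2 (fourier_fun n)"
  by (simp add: ebasis_def fourier_fun_def[abs_def] id_def)

lemma ae_eq_refl: "ae_eq f f \<longleftrightarrow> sq_integrable f"
  by (simp add: ae_eq_def)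

lemma inner_abs_l2:
  "sq_integrable f \<Longrightarrow> sq_integrable g \<Longrightarrow>
     inner (abs_l2 f) (abs_l2 g) = (LINT x|lebesgue_on {0<..<1}. f x * g x)"
  by (simp add: inner_l2.abs_eq ae_eq_refl)

lemma integral_unit_interval:
  fixes f F :: "real \<Rightarrow> real"
  assumes "\<And>x. (F has_real_derivative f x) (at x)" "continuous_on UNIV f"
  shows "(LINT x|lebesgue_on {0<..<1}. f x) = F 1 - F 0"
proof -
  have "(f has_integral (F 1 - F 0)) {0..1}"
    by (rule fundamental_theorem_of_calculus)
       (auto intro: has_field_derivative_at_within assms simp: has_real_derivative_iff_has_vector_derivative[symmetric])
  then have 1: "(f has_integral (F 1 - F 0)) {0<..<1}"
    using has_integral_Icc_iff_Ioo by blast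
  have "f absolutely_integrable_on {0..1}"
    by (rule absolutely_integrable_continuous_real) (rule continuous_on_subset[OF assms(2)], simp)
  then have "f absolutely_integrable_on {0<..<1}"
    by (rule set_integrable_subset) auto
  then have "integrable (lebesgue_on {0<..<1}) f"
    by (simp add: absolutely_integrable_imp_integrable)
  then show ?thesis using 1 lebesgue_integral_eq_integral[of "{0<..<1}" f] by (simp add: integral_unique)
qed

lemma integral_cos_period:
  "(LINT x|lebesgue_on {0<..<1}. cos (2 * of_int m * pi * x)) = (if m = 0 then 1 else 0)"
proof (cases "m = 0")
  case True
  then show ?thesis using integral_unit_interval[of "\<lambda>x. x" "\<lambda>_. 1"] by simp
next
  case False
  have "(LINT x|lebesgue_on {0<..<1}. cos (2 * of_int m * pi * x))
      = sin (2 * of_int m * pi * 1) / (2 * of_int m * pi) - sin (2 * of_int m * pi * 0) / (2 * of_int m * pi)"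
    by (rule integral_unit_interval)
       (use False in \<open>auto intro!: derivative_eq_intros continuous_intros\<close>)
  then show ?thesis using False sin_int_2pin[of m] by (simp add: mult_ac)
qed

lemma integral_sin_period:
  "(LINT x|lebesgue_on {0<..<1}. sin (2 * of_int m * pi * x)) = 0"
proof (cases "m = 0")
  case False
  have "(LINT x|lebesgue_on {0<..<1}. sin (2 * of_int m * pi * x))
      = - cos (2 * of_int m * pi * 1) / (2 * of_int m * pi) - - cos (2 * of_int m * pi * 0) / (2 * of_int m * pi)"
    by (rule integral_unit_interval)
       (use False in \<open>auto intro!: derivative_eq_intros continuous_intros\<close>)
  then show ?thesis using False cos_int_2pin[of m] by (simp add: mult_ac)
qed simp

lemma integrable_lebesgue_on_unit:
  fixes f :: "real \<Rightarrow> real"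
  assumes "continuous_on UNIV f" "\<And>x. \<bar>f x\<bar> \<le> B"
  shows "integrable (lebesgue_on {0<..<1}) f"
  using sq_integrable_mult[OF sq_integrable_continuous_bounded[OF assms]
     sq_integrable_continuous_bounded[of "\<lambda>_. 1" 1]] by simp

text \<open>An inductive description rather than explicit coefficient sequences: closure under products is then
  a double induction over the product-to-sum formulas.\<close>

inductive trig_poly :: "(real \<Rightarrow> real) \<Rightarrow> bool" where
  cos: "trig_poly (\<lambda>x. cos (2 * of_int n * pi * x))"
| sin: "trig_poly (\<lambda>x. sin (2 * of_int n * pi * x))"
| add: "trig_poly f \<Longrightarrow> trig_poly g \<Longrightarrow> trig_poly (\<lambda>x. f x + g x)"
| scale: "trig_poly f \<Longrightarrow> trig_poly (\<lambda>x. c * f x)"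

lemma trig_poly_const: "trig_poly (\<lambda>x. c)"
  using trig_poly.scale[OF trig_poly.cos[of 0], of c] by simp

lemma trig_poly_sum: "(\<And>i. i \<in> I \<Longrightarrow> trig_poly (f i)) \<Longrightarrow> trig_poly (\<lambda>x. \<Sum>i\<in>I. f i x)"
  by (induction I rule: infinite_finite_induct) (auto intro: trig_poly.intros trig_poly_const)

lemma trig_poly_fourier_fun: "trig_poly (fourier_fun n)"
proof -
  consider "n = 0" | "n > 0" | "n < 0" by linarith
  then show ?thesis
  proof cases
    case 1 then show ?thesis by (simp add: fourier_fun_def[abs_def] trig_poly_const)
  next
    case 2 then show ?thesis using trig_poly.scale[OF trig_poly.cos[of n], of "sqrt 2"]
      by (simp add: fourier_fun_def[abs_def])
  next
    case 3 then show ?thesis using trig_poly.scale[OF trig_poly.sin[of "-n"], of "sqrt 2"]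
      by (simp add: fourier_fun_def[abs_def])
  qed
qed

lemma angle_add: "2 * of_int (n + m) * pi * x = 2 * of_int n * pi * x + 2 * of_int m * pi * x"
  and angle_diff: "2 * of_int (n - m) * pi * x = 2 * of_int n * pi * x - 2 * of_int m * pi * x"
  by (simp_all add: algebra_simps)

text \<open>The inner induction for closure under products; the product-to-sum formulas mix sines and cosines,
  which is why both multiplications are treated together.\<close>

lemma trig_poly_mult_cos_sin:
  assumes "trig_poly g"
  shows "trig_poly (\<lambda>x. cos (2 * of_int n * pi * x) * g x) \<and> trig_poly (\<lambda>x. sin (2 * of_int n * pi * x) * g x)"
  using assms
proof induction
  case (cos m)
  note C = trig_poly.scale[OF trig_poly.add[OF trig_poly.cos[of "n - m"] trig_poly.cos[of "n + m"]], of "1/2"]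
  note D = trig_poly.scale[OF trig_poly.add[OF trig_poly.sin[of "n + m"] trig_poly.sin[of "n - m"]], of "1/2"]
  have "cos (2 * of_int n * pi * x) * cos (2 * of_int m * pi * x)
     = 1/2 * (cos (2 * of_int (n - m) * pi * x) + cos (2 * of_int (n + m) * pi * x))" for x
    unfolding angle_add angle_diff cos_times_cos by simp
  moreover have "sin (2 * of_int n * pi * x) * cos (2 * of_int m * pi * x)
     = 1/2 * (sin (2 * of_int (n + m) * pi * x) + sin (2 * of_int (n - m) * pi * x))" for x
    unfolding angle_add angle_diff sin_times_cos by simp
  ultimately show ?case using C D by (simp only: simp_thms)
next
  case (sin m)
  note C = trig_poly.scale[OF trig_poly.add[OF trig_poly.cos[of "n - m"]
     trig_poly.scale[OF trig_poly.cos[of "n + m"], of "-1"]], of "1/2"]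
  note D = trig_poly.scale[OF trig_poly.add[OF trig_poly.sin[of "n + m"]
     trig_poly.scale[OF trig_poly.sin[of "n - m"], of "-1"]], of "1/2"]
  have "sin (2 * of_int n * pi * x) * sin (2 * of_int m * pi * x)
     = 1/2 * (cos (2 * of_int (n - m) * pi * x) + (-1) * cos (2 * of_int (n + m) * pi * x))" for x
    unfolding angle_add angle_diff sin_times_sin by simp
  moreover have "cos (2 * of_int n * pi * x) * sin (2 * of_int m * pi * x)
     = 1/2 * (sin (2 * of_int (n + m) * pi * x) + (-1) * sin (2 * of_int (n - m) * pi * x))" for x
    unfolding angle_add angle_diff cos_times_sin by simp
  ultimately show ?case using C D by (simp only: simp_thms)
next
  case (add f g)
  then show ?case
    by (auto simp: distrib_left intro: trig_poly.add)
next
  case (scale f c)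
  then show ?case
    using trig_poly.scale[of _ c] by (auto simp: mult.left_commute[of _ c])
qed

lemma trig_poly_mult:
  assumes "trig_poly f" "trig_poly g"
  shows "trig_poly (\<lambda>x. f x * g x)"
  using assms
proof induction
  case (add f1 f2)
  then show ?case using trig_poly.add by (simp add: distrib_right)
next
  case (scale f c)
  then show ?case using trig_poly.scale[of _ c] by (simp add: mult.assoc)
qed (use trig_poly_mult_cos_sin in blast)+

lemma trig_poly_power: "trig_poly f \<Longrightarrow> trig_poly (\<lambda>x. f x ^ k)"
  by (induction k) (auto intro: trig_poly_const trig_poly_mult)

lemma trig_poly_bounded: "trig_poly f \<Longrightarrow> \<exists>B. \<forall>x. \<bar>f x\<bar> \<le> B"
proof (induction rule: trig_poly.induct)
  case (add f g)
  then obtain A B where "\<forall>x. \<bar>f x\<bar> \<le> A" "\<forall>x. \<bar>g x\<bar> \<le> B" by blast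
  then have "\<forall>x. \<bar>f x + g x\<bar> \<le> A + B" by (metis abs_triangle_ineq add_mono order_trans)
  then show ?case by blast
next
  case (scale f c)
  then obtain A where "\<forall>x. \<bar>f x\<bar> \<le> A" by blast
  then have "\<forall>x. \<bar>c * f x\<bar> \<le> \<bar>c\<bar> * A" by (simp add: abs_mult mult_left_mono)
  then show ?case by blast
qed (auto intro: exI[of _ 1])

lemma trig_poly_continuous: "trig_poly f \<Longrightarrow> continuous_on UNIV f"
  by (induction rule: trig_poly.induct) (auto intro!: continuous_intros)

lemma sq_integrable_trig_poly: "trig_poly f \<Longrightarrow> sq_integrable f"
  using sq_integrable_continuous_bounded trig_poly_continuous trig_poly_bounded by metis

lemma integrable_trig_poly: "trig_poly f \<Longrightarrow> integrable (lebesgue_on {0<..<1}) f"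
  using integrable_lebesgue_on_unit trig_poly_continuous trig_poly_bounded by metis

lemma plus_abs_l2: "sq_integrable f \<Longrightarrow> sq_integrable g \<Longrightarrow> abs_l2 f + abs_l2 g = abs_l2 (\<lambda>x. f x + g x)"
  by (simp add: plus_l2.abs_eq ae_eq_refl)

lemma scaleR_abs_l2: "sq_integrable f \<Longrightarrow> c *\<^sub>R abs_l2 f = abs_l2 (\<lambda>x. c * f x)"
  by (simp add: scaleR_l2.abs_eq ae_eq_refl)

lemma sum_scaleR_abs_l2:
  assumes "finite I" "\<And>i. i \<in> I \<Longrightarrow> trig_poly (f i)"
  shows "(\<Sum>i\<in>I. c i *\<^sub>R abs_l2 (f i)) = abs_l2 (\<lambda>x. \<Sum>i\<in>I. c i * f i x)"
  using assms
proof (induction I rule: finite_induct)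
  case empty
  show ?case by (simp add: zero_l2_def)
next
  case (insert i I)
  have "trig_poly (\<lambda>x. c i * f i x)" "trig_poly (\<lambda>x. \<Sum>i\<in>I. c i * f i x)"
    using insert.prems by (auto intro!: trig_poly_sum trig_poly.scale)
  then show ?case using insert
    by (simp add: plus_abs_l2 scaleR_abs_l2 sq_integrable_trig_poly)
qed

lemma l2_power_abs_l2: "trig_poly f \<Longrightarrow> l2_power (abs_l2 f) k = abs_l2 (\<lambda>x. f x ^ k)"
  by (subst l2_power.abs_eq) (auto simp: ae_eq_refl sq_integrable_trig_poly trig_poly_power)

text \<open>The nonlinearity leaves the range of \<^const>\<open>proj\<close>, but by this fact it stays in the
  algebraic span of the basis, where the smoothing operators can be computed term by term.\<close>

lemma abs_l2_trig_poly_in_span: "trig_poly f \<Longrightarrow> abs_l2 f \<in> span (range ebasis)"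
proof (induction rule: trig_poly.induct)
  have sc: "abs_l2 (\<lambda>x. (1 / sqrt 2) * fourier_fun n x) \<in> span (range ebasis)" for n
    using span_scale[OF span_base[of "ebasis n" "range ebasis"], of "1 / sqrt 2"]
    by (simp add: ebasis_eq_abs scaleR_abs_l2 sq_integrable_fourier_fun)
  {
    case (cos n)
    have "(\<lambda>x. cos (2 * of_int n * pi * x)) = (\<lambda>x. (1 / sqrt 2) * fourier_fun \<bar>n\<bar> x)" if "n \<noteq> 0"
    proof
      fix x
      have "cos (2 * of_int \<bar>n\<bar> * pi * x) = cos (2 * of_int n * pi * x)"
        by (cases "n > 0") auto
      then show "cos (2 * of_int n * pi * x) = (1 / sqrt 2) * fourier_fun \<bar>n\<bar> x"
        using that by (simp add: fourier_fun_def)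
    qed
    moreover have "(\<lambda>x. cos (2 * of_int n * pi * x)) = fourier_fun 0" if "n = 0"
      using that by (simp add: fourier_fun_def[abs_def])
    ultimately show ?case using sc[of "\<bar>n\<bar>"] span_base[of "ebasis 0" "range ebasis"]
      by (cases "n = 0") (simp_all add: ebasis_eq_abs)
  next
    case (sin n)
    consider "n = 0" | "n > 0" | "n < 0" by linarith
    then show ?case
    proof cases
      case 1
      have "abs_l2 (\<lambda>_. 0) \<in> span (range ebasis)"
        using span_zero[of "range ebasis"] by (simp add: zero_l2_def)
      then show ?thesis using 1 by simp
    next
      case 2
      then have "(\<lambda>x. sin (2 * of_int n * pi * x)) = (\<lambda>x. (1 / sqrt 2) * fourier_fun (- n) x)"
        by (auto simp: fourier_fun_def)
      then show ?thesis using sc by simp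
    next
      case 3
      then have "(\<lambda>x. sin (2 * of_int n * pi * x)) = (\<lambda>x. (-1) * ((1 / sqrt 2) * fourier_fun n x))"
        by (auto simp: fourier_fun_def)
      then show ?thesis
        using span_scale[OF sc[of n], of "-1"]
        by (simp only: scaleR_abs_l2 sq_integrable_scale sq_integrable_fourier_fun)
    qed
  }
next
  case (add f g)
  then show ?case using span_add[of "abs_l2 f" _ "abs_l2 g"]
    by (simp add: plus_abs_l2 sq_integrable_trig_poly)
next
  case (scale f c)
  then show ?case using span_scale[of "abs_l2 f" _ c]
    by (simp add: scaleR_abs_l2 sq_integrable_trig_poly)
qed

lemma inner_ebasis: "inner (ebasis m) (ebasis n) = (if m = n then 1 else 0)"
proof -
  have i: "integrable (lebesgue_on {0<..<1}) (\<lambda>x. cos (2 * of_int k * pi * x))"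
      "integrable (lebesgue_on {0<..<1}) (\<lambda>x. sin (2 * of_int k * pi * x))" for k
    by (rule integrable_trig_poly trig_poly.cos trig_poly.sin)+
  have cc: "(LINT x|lebesgue_on {0<..<1}. cos (2 * of_int k * pi * x) * cos (2 * of_int l * pi * x))
      = (if k - l = 0 then 1/2 else 0) + (if k + l = 0 then 1/2 else 0)" for k l
  proof -
    have "cos (2 * of_int k * pi * x) * cos (2 * of_int l * pi * x)
       = (cos (2 * of_int (k - l) * pi * x) + cos (2 * of_int (k + l) * pi * x)) / 2" for x
      unfolding angle_add angle_diff cos_times_cos by simp
    then show ?thesis using i(1) by (simp only: integral_divide_zero Bochner_Integration.integral_add integral_cos_period) auto
  qed
  have ss: "(LINT x|lebesgue_on {0<..<1}. sin (2 * of_int k * pi * x) * sin (2 * of_int l * pi * x))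
      = (if k - l = 0 then 1/2 else 0) - (if k + l = 0 then 1/2 else 0)" for k l
  proof -
    have "sin (2 * of_int k * pi * x) * sin (2 * of_int l * pi * x)
       = (cos (2 * of_int (k - l) * pi * x) - cos (2 * of_int (k + l) * pi * x)) / 2" for x
      unfolding angle_add angle_diff sin_times_sin by simp
    then show ?thesis using i(1) by (simp only: integral_divide_zero Bochner_Integration.integral_diff integral_cos_period) auto
  qed
  have sc: "(LINT x|lebesgue_on {0<..<1}. sin (2 * of_int k * pi * x) * cos (2 * of_int l * pi * x)) = 0" for k l
  proof -
    have "sin (2 * of_int k * pi * x) * cos (2 * of_int l * pi * x)
       = (sin (2 * of_int (k + l) * pi * x) + sin (2 * of_int (k - l) * pi * x)) / 2" for x
      unfolding angle_add angle_diff sin_times_cos by simp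
    then show ?thesis using i(2) by (simp only: integral_divide_zero Bochner_Integration.integral_add integral_sin_period) auto
  qed
  define C where "C n = (\<lambda>x. cos (2 * of_int n * pi * x))" for n :: int
  define D where "D n = (\<lambda>x. sin (2 * of_int n * pi * x))" for n :: int
  have f: "fourier_fun n = (\<lambda>x. (if n = 0 then 1 else sqrt 2) * (if n \<ge> 0 then C n x else D (- n) x))" for n
    by (auto simp: fourier_fun_def C_def D_def)
  have "inner (ebasis m) (ebasis n) = (LINT x|lebesgue_on {0<..<1}. fourier_fun m x * fourier_fun n x)"
    by (simp add: ebasis_eq_abs inner_abs_l2 sq_integrable_fourier_fun)
  also have "\<dots> = (if m = 0 then 1 else sqrt 2) * (if n = 0 then 1 else sqrt 2) *
     (LINT x|lebesgue_on {0<..<1}. (if m \<ge> 0 then C m x else D (- m) x) * (if n \<ge> 0 then C n x else D (- n) x))"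
    unfolding f by (simp only: integral_mult_right_zero[symmetric] mult_ac)
  also have "\<dots> = (if m = n then 1 else 0)"
    using cc[of m n] ss[of "-m" "-n"] sc[of "-m" n] sc[of "-n" m]
    by (cases "m \<ge> 0"; cases "n \<ge> 0") (auto simp: C_def D_def mult.commute)
  finally show ?thesis .
qed

lemma abs_inner_ebasis_le:
  assumes "trig_poly f" "\<And>x. \<bar>f x\<bar> \<le> B"
  shows "\<bar>inner (ebasis k) (abs_l2 f)\<bar> \<le> 2 * B"
proof -
  have tp: "trig_poly (\<lambda>x. fourier_fun k x * f x)"
    by (intro trig_poly_mult trig_poly_fourier_fun assms)
  have b: "\<bar>fourier_fun k x * f x\<bar> \<le> 2 * B" for x
    using mult_mono[OF abs_fourier_fun_le[of k x] assms(2)[of x]] by (simp add: abs_mult)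
  have p: "prob_space (lebesgue_on {0<..<1::real})"
    by (rule prob_spaceI) (simp add: emeasure_restrict_space)
  have "\<bar>inner (ebasis k) (abs_l2 f)\<bar> = \<bar>LINT x|lebesgue_on {0<..<1}. fourier_fun k x * f x\<bar>"
    by (simp add: ebasis_eq_abs inner_abs_l2 sq_integrable_fourier_fun sq_integrable_trig_poly assms)
  also have "\<dots> \<le> (LINT x|lebesgue_on {0<..<1}. \<bar>fourier_fun k x * f x\<bar>)"
    by (rule integral_abs_bound)
  also have "\<dots> \<le> 2 * B"
    by (rule prob_space.integral_le_const[OF p]) (use integrable_trig_poly[OF tp] b in auto)
  finally show ?thesis .
qed

section \<open>Smoothing operators and noise in Fourier coefficients\<close>

definition fourier_sum :: "nat \<Rightarrow> (int \<Rightarrow> real) \<Rightarrow> real \<Rightarrow> real" where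
  "fourier_sum N y x = (\<Sum>k\<in>{- int N..int N}. y k * fourier_fun k x)"

lemma trig_poly_fourier_sum: "trig_poly (fourier_sum N y)"
  unfolding fourier_sum_def[abs_def]
  by (intro trig_poly_sum trig_poly.scale trig_poly_fourier_fun)

lemma proj_eq_abs_l2: "proj N v = abs_l2 (fourier_sum N (\<lambda>k. inner (ebasis k) v))"
  unfolding proj_def fourier_sum_def[abs_def]
  by (subst sum_scaleR_abs_l2[symmetric]) (auto simp: trig_poly_fourier_fun ebasis_eq_abs)

lemma inner_ebasis_proj:
  "inner (ebasis k) (proj N v) = (if \<bar>k\<bar> \<le> int N then inner (ebasis k) v else 0)"
proof -
  have "inner (ebasis k) (proj N v)
      = (\<Sum>n\<in>{- int N..int N}. if n = k then inner (ebasis k) v else 0)"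
    unfolding proj_def inner_sum_right by (rule sum.cong) (auto simp: inner_ebasis)
  then show ?thesis by (auto simp: abs_le_iff)
qed

lemma proj_proj: "proj N (proj N v) = proj N v"
proof -
  have "proj N (proj N v) = (\<Sum>n\<in>{- int N..int N}. inner (ebasis n) (proj N v) *\<^sub>R ebasis n)"
    by (rule proj_def)
  also have "\<dots> = (\<Sum>n\<in>{- int N..int N}. inner (ebasis n) v *\<^sub>R ebasis n)"
    by (rule sum.cong) (auto simp: inner_ebasis_proj)
  finally show ?thesis by (simp only: proj_def)
qed

lemma abs_inner_ebasis_le_norm: "\<bar>inner (ebasis k) v\<bar> \<le> norm v"
  using Cauchy_Schwarz_ineq2[of "ebasis k" v] by (simp add: norm_eq_sqrt_inner[of "ebasis k"] inner_ebasis)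

lemma infsum_ebasis_single:
  "(\<Sum>\<^sub>\<infinity>m\<in>UNIV. (c m * inner (ebasis m) (ebasis n)) *\<^sub>R ebasis m) = c n *\<^sub>R ebasis n"
  by (rule infsumI, rule has_sum_finite_neutralI[where B = "{n}"]) (auto simp: inner_ebasis)

lemma inner_ebasis_heat:
  "inner (ebasis k) (heat t (ebasis n)) = (if k = n then exp (- 4 * pi\<^sup>2 * (of_int k)\<^sup>2 * t) else 0)"
  unfolding heat_def infsum_ebasis_single by (simp add: inner_ebasis)

text \<open>The resolvent is an inverse of \<open>u \<mapsto> u - t *\<^sub>R lap u\<close> chosen on the
  domain, so the chosen preimage \<open>u\<close> of a basis vector has to be identified. If the series defining
  \<open>lap u\<close> converges, pairing it with a basis vector gives the coefficients of \<open>u\<close>.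
  Divergence is impossible: a divergent sum is zero by convention, so \<open>u\<close> would be the basis vector
  itself, whose series has a single nonzero term.\<close>

lemma inner_ebasis_resolvent:
  assumes "0 \<le> t"
  shows "inner (ebasis k) (resolvent t (ebasis n)) =
    (if k = n then 1 / (1 + 4 * pi\<^sup>2 * (of_int k)\<^sup>2 * t) else 0)"
proof -
  define \<mu> :: "int \<Rightarrow> real" where "\<mu> k = 4 * pi\<^sup>2 * (of_int k)\<^sup>2" for k
  have pos: "1 + \<mu> k * t > 0" for k
    using assms by (auto simp: \<mu>_def intro!: add_pos_nonneg)
  define u0 where "u0 = (1 / (1 + \<mu> n * t)) *\<^sub>R ebasis n"
  have lap_e: "lap (c *\<^sub>R ebasis n) = (- \<mu> n * c) *\<^sub>R ebasis n" for c
    using infsum_ebasis_single[of "\<lambda>m. - \<mu> m * c" n] by (simp add: lap_def \<mu>_def mult.assoc)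
  have "finite {m. of_int m ^ 4 * (inner (ebasis m) u0)\<^sup>2 \<noteq> 0}"
    by (rule finite_subset[of _ "{n}"]) (auto simp: u0_def inner_ebasis split: if_splits)
  then have "u0 \<in> lap_dom"
    unfolding lap_dom_def by (auto intro: finite_nonzero_values_imp_summable_on)
  moreover have "u0 - t *\<^sub>R lap u0 = ebasis n"
  proof -
    have "u0 - t *\<^sub>R lap u0 = (1 / (1 + \<mu> n * t) + t * (\<mu> n * (1 / (1 + \<mu> n * t)))) *\<^sub>R ebasis n"
      unfolding u0_def lap_e by (simp add: scaleR_add_left)
    also have "1 / (1 + \<mu> n * t) + t * (\<mu> n * (1 / (1 + \<mu> n * t))) = 1"
      using pos[of n] by (simp add: field_simps)
    finally show ?thesis by simp
  qed
  \<comment> \<open>Only because a preimage exists is the chosen inverse a preimage.\<close>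
  ultimately have "ebasis n \<in> (\<lambda>u. u - t *\<^sub>R lap u) ` lap_dom" by force
  define u where "u = resolvent t (ebasis n)"
  have u: "u - t *\<^sub>R lap u = ebasis n"
    unfolding u_def resolvent_def by (rule f_inv_into_f[OF \<open>ebasis n \<in> _\<close>])
  define g where "g m = (- 4 * pi\<^sup>2 * (of_int m)\<^sup>2 * inner (ebasis m) u) *\<^sub>R ebasis m" for m
  have lap_g: "lap u = infsum g UNIV" unfolding lap_def by (rule infsum_cong) (simp only: g_def)
  have "g summable_on UNIV"
  proof (rule ccontr)
    assume ns: "\<not> g summable_on UNIV"
    then have "u = ebasis n" using u lap_g by (simp add: infsum_not_exists)
    then have "{m \<in> UNIV. g m \<noteq> 0} \<subseteq> {n}"
      by (auto simp: g_def inner_ebasis split: if_splits)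
    then have "finite {m \<in> UNIV. g m \<noteq> 0}" by (rule finite_subset) simp
    then show False using ns finite_nonzero_values_imp_summable_on by blast
  qed
  then have "(g has_sum lap u) UNIV" by (simp add: lap_g)
  then have "((\<lambda>m. inner (ebasis k) (g m)) has_sum inner (ebasis k) (lap u)) UNIV"
    by (rule has_sum_bounded_linear[OF bounded_linear_inner_right])
  moreover have "((\<lambda>m. inner (ebasis k) (g m)) has_sum (- \<mu> k * inner (ebasis k) u)) UNIV"
    by (rule has_sum_finite_neutralI[where B = "{k}"]) (auto simp: g_def inner_ebasis \<mu>_def)
  ultimately have "inner (ebasis k) (lap u) = - \<mu> k * inner (ebasis k) u"
    by (rule has_sum_unique)
  then have "inner (ebasis k) u * (1 + \<mu> k * t) = inner (ebasis k) (ebasis n)"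
    unfolding u[symmetric] inner_diff_right inner_scaleR_right by (simp add: algebra_simps)
  then have "inner (ebasis k) u = inner (ebasis k) (ebasis n) / (1 + \<mu> k * t)"
    using pos[of k] by (simp add: field_simps)
  then show ?thesis by (simp add: u_def inner_ebasis \<mu>_def)
qed

text \<open>The common features of the two admissible smoothing operators. The multiplier \<open>1\<close> on
  constants lets the mean grow undamped, and the bound on the others keeps the remaining modes from being
  amplified.\<close>

definition diagonal_smoother :: "(l2 \<Rightarrow> 'b::{real_inner,banach}) \<Rightarrow> ('b \<Rightarrow> l2) \<Rightarrow> (int \<Rightarrow> real) \<Rightarrow> bool" where
  "diagonal_smoother \<iota> S \<mu> \<longleftrightarrow> linear \<iota> \<and> bounded_linear S \<and> \<mu> 0 = 1 \<and> (\<forall>k. \<bar>\<mu> k\<bar> \<le> 1) \<and>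
     (\<forall>k n. inner (ebasis k) (S (\<iota> (ebasis n))) = (if k = n then \<mu> k else 0))"

lemma diagonal_smoother_exists:
  assumes "linear \<iota>" "0 \<le> t"
    and "continuous_extension \<iota> (heat t) S \<or> continuous_extension \<iota> (resolvent t) S"
  shows "\<exists>\<mu>. diagonal_smoother \<iota> S \<mu>"
  using assms(3)
proof
  assume "continuous_extension \<iota> (heat t) S"
  then have "diagonal_smoother \<iota> S (\<lambda>k. exp (- 4 * pi\<^sup>2 * (of_int k)\<^sup>2 * t))"
    using assms(1,2) by (auto simp: diagonal_smoother_def continuous_extension_def inner_ebasis_heat)
  then show ?thesis by blast
next
  assume R: "continuous_extension \<iota> (resolvent t) S"
  have "0 \<le> 4 * pi\<^sup>2 * (of_int k)\<^sup>2 * t" for k :: int using assms(2) by simp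
  then have "1 \<le> 1 + 4 * pi\<^sup>2 * (of_int k)\<^sup>2 * t" for k :: int by (simp only: le_add_same_cancel1)
  then have "\<bar>1 / (1 + 4 * pi\<^sup>2 * (of_int k)\<^sup>2 * t)\<bar> \<le> 1" for k :: int
    by (smt (verit) divide_le_eq_1_pos zero_le_divide_1_iff)
  then have "diagonal_smoother \<iota> S (\<lambda>k. 1 / (1 + 4 * pi\<^sup>2 * (of_int k)\<^sup>2 * t))"
    using assms(1,2) R by (simp add: diagonal_smoother_def continuous_extension_def inner_ebasis_resolvent)
  then show ?thesis by blast
qed

lemma inner_diagonal_smoother_span:
  assumes "diagonal_smoother \<iota> S \<mu>" "v \<in> span (range ebasis)"
  shows "inner (ebasis k) (S (\<iota> v)) = \<mu> k * inner (ebasis k) v"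
  using assms(2)
proof (induction rule: span_induct_alt)
  case base
  then show ?case using assms(1)
    by (simp add: diagonal_smoother_def linear_0 bounded_linear.linear)
next
  case (step c x y)
  have "linear \<iota>" "linear S"
    using assms(1) by (auto simp: diagonal_smoother_def bounded_linear.linear)
  then have "S (\<iota> (c *\<^sub>R x + y)) = c *\<^sub>R S (\<iota> x) + S (\<iota> y)"
    by (simp add: linear_add linear_scale)
  moreover obtain n where "x = ebasis n" using step by blast
  moreover have "inner (ebasis k) (S (\<iota> (ebasis n))) = \<mu> k * inner (ebasis k) (ebasis n)"
    using assms(1) by (simp add: diagonal_smoother_def inner_ebasis)
  ultimately show ?case using step by (simp add: inner_add_right algebra_simps)
qed

lemma inner_diagonal_smoother_series:
  assumes "diagonal_smoother \<iota> S \<mu>" "((\<lambda>n. b n *\<^sub>R \<iota> (ebasis n)) has_sum w) UNIV"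
  shows "inner (ebasis k) (S w) = \<mu> k * b k"
proof -
  have lin: "bounded_linear (\<lambda>x. inner (ebasis k) (S x))"
    using assms(1) by (auto simp: diagonal_smoother_def
       intro: bounded_linear_compose[OF bounded_linear_inner_right])
  have "((\<lambda>n. inner (ebasis k) (S (b n *\<^sub>R \<iota> (ebasis n)))) has_sum inner (ebasis k) (S w)) UNIV"
    by (rule has_sum_bounded_linear[OF lin assms(2)])
  moreover have "((\<lambda>n. inner (ebasis k) (S (b n *\<^sub>R \<iota> (ebasis n)))) has_sum (\<mu> k * b k)) UNIV"
    by (rule has_sum_finite_neutralI[where B = "{k}"])
       (use assms(1) in \<open>auto simp: diagonal_smoother_def bounded_linear.linear linear_scale\<close>)
  ultimately show ?thesis by (rule has_sum_unique)
qed

definition nonlinearity :: "(nat \<Rightarrow> real) \<Rightarrow> nat \<Rightarrow> real \<Rightarrow> real" where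
  "nonlinearity a q y = (\<Sum>k=0..q. a k * y ^ k)"

lemma trig_poly_nonlinearity: "trig_poly f \<Longrightarrow> trig_poly (\<lambda>x. nonlinearity a q (f x))"
  unfolding nonlinearity_def by (intro trig_poly_sum trig_poly.scale trig_poly_power)

lemma sum_l2_power_eq:
  "trig_poly f \<Longrightarrow> (\<Sum>k=0..q. a k *\<^sub>R l2_power (abs_l2 f) k) = abs_l2 (\<lambda>x. nonlinearity a q (f x))"
  unfolding nonlinearity_def
  by (simp add: l2_power_abs_l2 sum_scaleR_abs_l2 trig_poly_power)

text \<open>One step of the scheme in Fourier coordinates. The smoothing operator commutes with taking
  coefficients for two different reasons: the drift part lies in the span of the basis, and the noise is a
  convergent series, through which the continuous functional passes.\<close>

lemma coefficient_recursion:
  assumes "diagonal_smoother \<iota> S \<mu>" "v = proj N v" "\<bar>k\<bar> \<le> int N"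
    and "((\<lambda>n. b n *\<^sub>R \<iota> (ebasis n)) has_sum w) UNIV"
    and "((\<lambda>n. b' n *\<^sub>R \<iota> (ebasis n)) has_sum w') UNIV"
  defines "y \<equiv> \<lambda>k. inner (ebasis k) v"
  shows "inner (ebasis k) (proj N (S (\<iota> (v + h *\<^sub>R (\<Sum>k=0..q. a k *\<^sub>R l2_power v k)) + (w' - w))))
     = \<mu> k * (y k + h * inner (ebasis k) (abs_l2 (\<lambda>x. nonlinearity a q (fourier_sum N y x))) + (b' k - b k))"
proof -
  let ?f = "fourier_sum N y"
  let ?F = "abs_l2 (\<lambda>x. nonlinearity a q (?f x))"
  have v: "v = abs_l2 ?f" using proj_eq_abs_l2[of N v] assms(2) unfolding y_def by (rule trans[rotated])
  have F: "(\<Sum>k=0..q. a k *\<^sub>R l2_power v k) = ?F"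
    using sum_l2_power_eq[OF trig_poly_fourier_sum[of N y], of a q] by (simp only: v[symmetric])
  have "abs_l2 ?f + h *\<^sub>R ?F \<in> span (range ebasis)"
    by (intro span_add span_scale abs_l2_trig_poly_in_span trig_poly_nonlinearity trig_poly_fourier_sum)
  then have "v + h *\<^sub>R ?F \<in> span (range ebasis)" by (simp only: v[symmetric])
  note 1 = inner_diagonal_smoother_span[OF assms(1) this]
  have "linear S" using assms(1) by (auto simp: diagonal_smoother_def bounded_linear.linear)
  then have "S (\<iota> (v + h *\<^sub>R ?F) + (w' - w)) = S (\<iota> (v + h *\<^sub>R ?F)) + (S w' - S w)"
    by (simp only: linear_add linear_diff)
  then have "inner (ebasis k) (S (\<iota> (v + h *\<^sub>R ?F) + (w' - w)))
     = \<mu> k * inner (ebasis k) (v + h *\<^sub>R ?F) + (\<mu> k * b' k - \<mu> k * b k)"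
    by (simp only: 1 inner_add_right inner_diff_right inner_diagonal_smoother_series[OF assms(1) assms(4)]
       inner_diagonal_smoother_series[OF assms(1) assms(5)])
  also have "inner (ebasis k) (v + h *\<^sub>R ?F) = y k + h * inner (ebasis k) ?F"
    by (simp add: inner_add_right y_def)
  finally show ?thesis
    using assms(3) unfolding F inner_ebasis_proj by (simp only: if_True) (simp only: right_diff_distrib distrib_left)
qed

section \<open>Growth of the polynomial nonlinearity\<close>

text \<open>The two properties of the polynomial from which the growth results: its modulus is of full order at
  large arguments, and it responds to a relative perturbation of its argument in a Lipschitz manner. The
  condition \<open>\<bar>a q\<bar> \<le> L\<close> is a normalisation that makes the tolerance chosen further
  down at most one.\<close>

definition growth_bounds :: "(nat \<Rightarrow> real) \<Rightarrow> nat \<Rightarrow> real \<Rightarrow> real \<Rightarrow> bool" where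
  "growth_bounds a q R L \<longleftrightarrow> 1 \<le> R \<and> \<bar>a q\<bar> \<le> L \<and>
     (\<forall>c. R \<le> \<bar>c\<bar> \<longrightarrow> \<bar>a q\<bar> / 2 * \<bar>c\<bar> ^ q \<le> \<bar>nonlinearity a q c\<bar>) \<and>
     (\<forall>c v. 1 \<le> \<bar>c\<bar> \<longrightarrow> \<bar>v\<bar> \<le> \<bar>c\<bar> \<longrightarrow>
        \<bar>nonlinearity a q (c + v) - nonlinearity a q c\<bar> \<le> L * \<bar>c\<bar> ^ (q - 1) * \<bar>v\<bar>)"

lemma abs_power_diff_le:
  fixes x y :: real
  assumes "\<bar>x\<bar> \<le> B" "\<bar>y\<bar> \<le> B"
  shows "\<bar>x ^ Suc k - y ^ Suc k\<bar> \<le> real (Suc k) * B ^ k * \<bar>x - y\<bar>"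
proof (induction k)
  case (Suc k)
  have B: "0 \<le> B" using assms(1) by linarith
  have "x ^ Suc (Suc k) - y ^ Suc (Suc k) = x * (x ^ Suc k - y ^ Suc k) + (x - y) * y ^ Suc k"
    by (simp add: algebra_simps)
  also have "\<bar>\<dots>\<bar> \<le> \<bar>x\<bar> * \<bar>x ^ Suc k - y ^ Suc k\<bar> + \<bar>x - y\<bar> * \<bar>y\<bar> ^ Suc k"
    unfolding abs_mult[symmetric] power_abs[symmetric] by (rule abs_triangle_ineq)
  also have "\<bar>x\<bar> * \<bar>x ^ Suc k - y ^ Suc k\<bar> \<le> B * (real (Suc k) * B ^ k * \<bar>x - y\<bar>)"
    by (rule mult_mono[OF assms(1) Suc]) (use B in auto)
  also have "\<bar>x - y\<bar> * \<bar>y\<bar> ^ Suc k \<le> \<bar>x - y\<bar> * B ^ Suc k"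
    by (intro mult_left_mono power_mono assms) auto
  finally show ?case by (simp add: algebra_simps)
qed simp

lemma growth_bounds_exist:
  assumes "1 \<le> q" "a q \<noteq> 0"
  shows "\<exists>R L. growth_bounds a q R L"
proof -
  define \<alpha> A where "\<alpha> = \<bar>a q\<bar>" and "A = (\<Sum>k<q. \<bar>a k\<bar>)"
  \<comment> \<open>At this height the lower-order terms make up at most half of the leading one.\<close>
  define R where "R = 1 + 2 * A / \<alpha>"
  define L where "L = \<alpha> + (\<Sum>k=0..q. \<bar>a k\<bar> * (real k * 2 ^ (k - 1)))"
  have \<alpha>: "\<alpha> > 0" and A: "A \<ge> 0" using assms by (auto simp: \<alpha>_def A_def intro: sum_nonneg)
  have R: "R \<ge> 1" using \<alpha> A by (simp add: R_def)
  have split: "nonlinearity a q c = (\<Sum>k<q. a k * c ^ k) + a q * c ^ q" for c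
    by (simp add: nonlinearity_def lessThan_Suc_atMost[symmetric] atLeast0AtMost)
  have low: "\<alpha> / 2 * \<bar>c\<bar> ^ q \<le> \<bar>nonlinearity a q c\<bar>" if c: "R \<le> \<bar>c\<bar>" for c
  proof -
    have "\<bar>\<Sum>k<q. a k * c ^ k\<bar> \<le> (\<Sum>k<q. \<bar>a k\<bar> * \<bar>c\<bar> ^ (q - 1))"
    proof (rule order_trans[OF sum_abs], rule sum_mono)
      fix k assume "k \<in> {..<q}"
      then have "\<bar>c\<bar> ^ k \<le> \<bar>c\<bar> ^ (q - 1)" using c R by (intro power_increasing) auto
      then show "\<bar>a k * c ^ k\<bar> \<le> \<bar>a k\<bar> * \<bar>c\<bar> ^ (q - 1)"
        by (simp add: abs_mult power_abs mult_left_mono)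
    qed
    also have "\<dots> = A * \<bar>c\<bar> ^ (q - 1)" by (simp add: A_def sum_distrib_right)
    also have "A * \<bar>c\<bar> ^ (q - 1) \<le> \<alpha> / 2 * \<bar>c\<bar> ^ q"
    proof -
      have "2 * A / \<alpha> \<le> \<bar>c\<bar>" using c by (simp add: R_def)
      then have "A \<le> \<alpha> / 2 * \<bar>c\<bar>" using \<alpha> by (simp add: field_simps)
      then have "A * \<bar>c\<bar> ^ (q - 1) \<le> \<alpha> / 2 * \<bar>c\<bar> * \<bar>c\<bar> ^ (q - 1)" by (intro mult_right_mono) auto
      also have "\<dots> = \<alpha> / 2 * \<bar>c\<bar> ^ q" using assms(1) by (cases q) auto
      finally show ?thesis .
    qed
    finally have "\<bar>\<Sum>k<q. a k * c ^ k\<bar> \<le> \<alpha> / 2 * \<bar>c\<bar> ^ q" .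
    moreover have "\<bar>a q * c ^ q\<bar> = \<alpha> * \<bar>c\<bar> ^ q" by (simp add: \<alpha>_def abs_mult power_abs)
    ultimately show ?thesis unfolding split by linarith
  qed
  have lip: "\<bar>nonlinearity a q (c + v) - nonlinearity a q c\<bar> \<le> L * \<bar>c\<bar> ^ (q - 1) * \<bar>v\<bar>"
    if c: "1 \<le> \<bar>c\<bar>" "\<bar>v\<bar> \<le> \<bar>c\<bar>" for c v
  proof -
    have 1: "\<bar>(c + v) ^ k - c ^ k\<bar> \<le> real k * 2 ^ (k - 1) * \<bar>c\<bar> ^ (q - 1) * \<bar>v\<bar>" if "k \<le> q" for k
    proof (cases k)
      case (Suc j)
      have "\<bar>(c + v) ^ Suc j - c ^ Suc j\<bar> \<le> real (Suc j) * (2 * \<bar>c\<bar>) ^ j * \<bar>c + v - c\<bar>"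
        by (rule abs_power_diff_le) (use c in linarith)+
      also have "\<dots> = real k * 2 ^ (k - 1) * \<bar>c\<bar> ^ (k - 1) * \<bar>v\<bar>"
        by (simp add: Suc power_mult_distrib)
      also have "\<dots> \<le> real k * 2 ^ (k - 1) * \<bar>c\<bar> ^ (q - 1) * \<bar>v\<bar>"
        using c that by (intro mult_right_mono mult_left_mono power_increasing) auto
      finally show ?thesis by (simp only: Suc)
    qed simp
    have "nonlinearity a q (c + v) - nonlinearity a q c = (\<Sum>k=0..q. a k * ((c + v) ^ k - c ^ k))"
      by (simp add: nonlinearity_def sum_subtractf right_diff_distrib)
    also have "\<bar>\<dots>\<bar> \<le> (\<Sum>k=0..q. \<bar>a k\<bar> * (real k * 2 ^ (k - 1) * \<bar>c\<bar> ^ (q - 1) * \<bar>v\<bar>))"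
    proof (rule order_trans[OF sum_abs], rule sum_mono)
      fix k assume "k \<in> {0..q}"
      then show "\<bar>a k * ((c + v) ^ k - c ^ k)\<bar> \<le> \<bar>a k\<bar> * (real k * 2 ^ (k - 1) * \<bar>c\<bar> ^ (q - 1) * \<bar>v\<bar>)"
        unfolding abs_mult[of "a k"] by (intro mult_left_mono 1) auto
    qed
    also have "\<dots> = (\<Sum>k=0..q. \<bar>a k\<bar> * (real k * 2 ^ (k - 1)) * (\<bar>c\<bar> ^ (q - 1) * \<bar>v\<bar>))"
      by (simp only: mult.assoc)
    also have "\<dots> = (L - \<alpha>) * (\<bar>c\<bar> ^ (q - 1) * \<bar>v\<bar>)"
      by (simp add: L_def flip: sum_distrib_right)
    also have "\<dots> \<le> L * (\<bar>c\<bar> ^ (q - 1) * \<bar>v\<bar>)"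
      using \<alpha> by (intro mult_right_mono) auto
    finally show ?thesis by (simp only: mult.assoc)
  qed
  have "\<alpha> \<le> L" by (auto simp: L_def intro!: sum_nonneg)
  with R low lip have "growth_bounds a q R L" by (simp add: growth_bounds_def \<alpha>_def)
  then show ?thesis by blast
qed

lemma abs_nonlinearity_le: "\<bar>nonlinearity a q y\<bar> \<le> (\<Sum>k=0..q. \<bar>a k\<bar>) * (1 + \<bar>y\<bar>) ^ q"
proof -
  have "\<bar>nonlinearity a q y\<bar> \<le> (\<Sum>k=0..q. \<bar>a k\<bar> * (1 + \<bar>y\<bar>) ^ q)"
    unfolding nonlinearity_def
  proof (rule order_trans[OF sum_abs], rule sum_mono)
    fix k assume "k \<in> {0..q}"
    then have "\<bar>y\<bar> ^ k \<le> (1 + \<bar>y\<bar>) ^ q"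
      by (intro order_trans[OF power_mono[of "\<bar>y\<bar>" "1 + \<bar>y\<bar>" k] power_increasing]) auto
    then show "\<bar>a k * y ^ k\<bar> \<le> \<bar>a k\<bar> * (1 + \<bar>y\<bar>) ^ q"
      by (simp add: abs_mult power_abs mult_left_mono)
  qed
  then show ?thesis by (simp only: sum_distrib_right)
qed

lemma abs_fourier_sum_le:
  assumes "\<And>k. \<bar>k\<bar> \<le> int N \<Longrightarrow> \<bar>y k\<bar> \<le> B"
  shows "\<bar>fourier_sum N y x\<bar> \<le> 2 * (2 * real N + 1) * B"
proof -
  have "\<bar>fourier_sum N y x\<bar> \<le> (\<Sum>k\<in>{- int N..int N}. B * 2)"
    unfolding fourier_sum_def
  proof (rule order_trans[OF sum_abs], rule sum_mono)
    fix k assume "k \<in> {- int N..int N}"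
    then have "\<bar>y k\<bar> \<le> B" using assms by (simp add: abs_le_iff)
    then show "\<bar>y k * fourier_fun k x\<bar> \<le> B * 2"
      unfolding abs_mult by (intro mult_mono abs_fourier_fun_le) auto
  qed
  then show ?thesis by (simp add: algebra_simps)
qed

section \<open>An invariant cone around the constants\<close>

text \<open>Smallness of the other modes is measured relative to the mean: the absolute deviation may grow as
  fast as the mean itself, whereas the ratio deteriorates only by a fixed factor per step.\<close>

definition in_cone :: "nat \<Rightarrow> real \<Rightarrow> (int \<Rightarrow> real) \<Rightarrow> bool" where
  "in_cone N \<rho> y \<longleftrightarrow> (\<forall>k. k \<noteq> 0 \<longrightarrow> \<bar>k\<bar> \<le> int N \<longrightarrow> \<bar>y k\<bar> \<le> \<rho> * \<bar>y 0\<bar>)"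

lemma fourier_sum_near_mean:
  assumes "in_cone N \<rho> y" "0 \<le> \<rho>"
  shows "\<bar>fourier_sum N y x - y 0\<bar> \<le> 4 * real N * \<rho> * \<bar>y 0\<bar>"
proof -
  let ?J = "{- int N..int N}"
  have "fourier_sum N y x = y 0 * fourier_fun 0 x + (\<Sum>k\<in>?J - {0}. y k * fourier_fun k x)"
    unfolding fourier_sum_def by (rule sum.remove) auto
  then have "fourier_sum N y x - y 0 = (\<Sum>k\<in>?J - {0}. y k * fourier_fun k x)"
    by (simp add: fourier_fun_def)
  also have "\<bar>\<dots>\<bar> \<le> (\<Sum>k\<in>?J - {0}. (\<rho> * \<bar>y 0\<bar>) * 2)"
  proof (rule order_trans[OF sum_abs], rule sum_mono)
    fix k assume "k \<in> ?J - {0}"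
    then have "\<bar>y k\<bar> \<le> \<rho> * \<bar>y 0\<bar>" using assms(1) by (auto simp: in_cone_def abs_le_iff)
    then show "\<bar>y k * fourier_fun k x\<bar> \<le> (\<rho> * \<bar>y 0\<bar>) * 2"
      unfolding abs_mult by (intro mult_mono abs_fourier_fun_le) (use assms(2) in auto)
  qed
  also have "\<dots> = 4 * real N * \<rho> * \<bar>y 0\<bar>" by (simp add: card_Diff_singleton)
  finally show ?thesis .
qed

lemma inner_ebasis_near_const:
  assumes "trig_poly f" "\<And>x. \<bar>f x - c\<bar> \<le> B"
  shows "\<bar>inner (ebasis k) (abs_l2 f) - (if k = 0 then c else 0)\<bar> \<le> 2 * B"
proof -
  have tp: "trig_poly (\<lambda>x. f x + (- c) * fourier_fun 0 x)"
    by (intro trig_poly.add trig_poly.scale trig_poly_fourier_fun assms)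
  have "abs_l2 (\<lambda>x. f x + (- c) * fourier_fun 0 x) = abs_l2 f + (- c) *\<^sub>R ebasis 0"
    unfolding ebasis_eq_abs
    by (simp only: scaleR_abs_l2 plus_abs_l2 sq_integrable_fourier_fun sq_integrable_scale
       sq_integrable_trig_poly[OF assms(1)])
  then have "inner (ebasis k) (abs_l2 (\<lambda>x. f x + (- c) * fourier_fun 0 x))
      = inner (ebasis k) (abs_l2 f) - (if k = 0 then c else 0)"
    by (simp add: inner_diff_right inner_ebasis)
  moreover have "\<bar>inner (ebasis k) (abs_l2 (\<lambda>x. f x + (- c) * fourier_fun 0 x))\<bar> \<le> 2 * B"
    by (rule abs_inner_ebasis_le[OF tp]) (use assms(2) in \<open>simp add: fourier_fun_def\<close>)
  ultimately show ?thesis by simp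
qed

text \<open>For a state in the cone, the nonlinearity is close to its value at the mean. With
  \<open>P = h * \<bar>a q\<bar> * \<bar>y 0\<bar> ^ q\<close>, the drift moves the mean by at least
  \<open>P / 2\<close> up to the deviation; the deviation takes at most \<open>P / 8\<close> of this, and the
  old mean together with the noise another \<open>P / 8\<close>. The deviation caused in the other modes is
  proportional to \<open>\<rho>\<close> with the same power of the mean, so after division by the new mean only
  the factor \<open>1 + 32 * N * L / \<bar>a q\<bar>\<close> is left.\<close>

lemma cone_step:
  fixes y y' w \<mu> :: "int \<Rightarrow> real" and a :: "nat \<Rightarrow> real" and q N :: nat
  defines "d \<equiv> \<lambda>k. inner (ebasis k) (abs_l2 (\<lambda>x. nonlinearity a q (fourier_sum N y x)))"
  assumes gb: "growth_bounds a q R L" and q: "1 \<le> q" "a q \<noteq> 0" and h: "0 < h"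
    and cone: "in_cone N \<rho> y" and \<epsilon>: "0 \<le> \<epsilon>" "\<epsilon> \<le> \<rho>" "\<epsilon> \<le> 1"
    and \<rho>: "4 * real N * \<rho> \<le> 1" "8 * real N * L * \<rho> \<le> \<bar>a q\<bar> / 8"
    and big: "R \<le> \<bar>y 0\<bar>" "16 \<le> h * \<bar>a q\<bar> * \<bar>y 0\<bar> ^ (q - 1)"
    and \<mu>: "\<mu> 0 = 1" "\<And>k. \<bar>\<mu> k\<bar> \<le> 1"
    and w: "\<And>k. \<bar>k\<bar> \<le> int N \<Longrightarrow> \<bar>w k\<bar> \<le> \<epsilon>"
    and y': "\<And>k. \<bar>k\<bar> \<le> int N \<Longrightarrow> y' k = \<mu> k * (y k + h * d k + w k)"
  shows "h * \<bar>a q\<bar> / 4 * \<bar>y 0\<bar> ^ q \<le> \<bar>y' 0\<bar>"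
    and "in_cone N ((1 + 32 * real N * L / \<bar>a q\<bar>) * \<rho>) y'"
proof -
  define \<alpha> c where "\<alpha> = \<bar>a q\<bar>" and "c = \<bar>y 0\<bar>"
  have \<alpha>: "\<alpha> > 0" using q by (simp add: \<alpha>_def)
  have \<rho>0: "0 \<le> \<rho>" using \<epsilon> by linarith
  have R: "1 \<le> R" and L: "\<alpha> \<le> L" using gb by (auto simp: growth_bounds_def \<alpha>_def)
  have c: "1 \<le> c" using R big by (simp add: c_def)
  have cq: "c ^ q = c ^ (q - 1) * c" using q by (cases q) auto
  \<comment> \<open>Pointwise, the state is a small relative perturbation of its mean.\<close>
  have near: "\<bar>fourier_sum N y x - y 0\<bar> \<le> 4 * real N * \<rho> * c" for x
    using fourier_sum_near_mean[OF cone \<rho>0] by (simp add: c_def)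
  have "4 * real N * \<rho> * c \<le> c" using mult_right_mono[OF \<rho>(1), of c] c by simp
  have lip: "\<bar>nonlinearity a q (y 0 + v) - nonlinearity a q (y 0)\<bar> \<le> L * c ^ (q - 1) * \<bar>v\<bar>"
    if "\<bar>v\<bar> \<le> c" for v
    using gb c that unfolding growth_bounds_def c_def by blast
  have dev: "\<bar>nonlinearity a q (fourier_sum N y x) - nonlinearity a q (y 0)\<bar> \<le> 4 * real N * L * \<rho> * c ^ q" for x
  proof -
    let ?v = "fourier_sum N y x - y 0"
    have "\<bar>?v\<bar> \<le> c" using near[of x] \<open>4 * real N * \<rho> * c \<le> c\<close> by linarith
    from lip[OF this]
    have "\<bar>nonlinearity a q (fourier_sum N y x) - nonlinearity a q (y 0)\<bar> \<le> L * c ^ (q - 1) * \<bar>?v\<bar>"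
      by simp
    also have "\<dots> \<le> L * c ^ (q - 1) * (4 * real N * \<rho> * c)"
      using L \<alpha> c by (intro mult_left_mono near) auto
    finally show ?thesis by (simp add: cq mult_ac)
  qed
  define E where "E = 8 * real N * L * \<rho> * c ^ q"
  have d: "\<bar>d k - (if k = 0 then nonlinearity a q (y 0) else 0)\<bar> \<le> E" for k
    using inner_ebasis_near_const[OF trig_poly_nonlinearity[OF trig_poly_fourier_sum] dev, of k]
    by (simp add: d_def E_def mult_ac)
  have E: "E \<le> \<alpha> / 8 * c ^ q"
    unfolding E_def using \<rho>(2) c by (intro mult_right_mono) (auto simp: \<alpha>_def)
  \<comment> \<open>The scale of the new mean, with which every error below is compared.\<close>
  define P where "P = h * \<alpha> * c ^ q"
  have P: "16 * c \<le> P"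
    using mult_right_mono[OF big(2)[folded c_def \<alpha>_def], of c] c by (simp add: P_def cq mult_ac)
  have hE: "h * E \<le> P / 8"
    using mult_left_mono[OF E, of h] h by (simp add: P_def mult_ac)
  have "\<alpha> / 2 * c ^ q \<le> \<bar>nonlinearity a q (y 0)\<bar>"
    using gb big by (simp add: growth_bounds_def c_def \<alpha>_def)
  then have "\<alpha> / 2 * c ^ q - E \<le> \<bar>d 0\<bar>" using d[of 0] by simp
  from mult_left_mono[OF this, of h] h have "P / 2 - h * E \<le> \<bar>h * d 0\<bar>"
    by (simp add: P_def abs_mult algebra_simps)
  moreover have "\<bar>w 0\<bar> \<le> \<epsilon>" using w by simp
  moreover have "\<bar>h * d 0\<bar> \<le> \<bar>y 0 + h * d 0 + w 0\<bar> + c + \<bar>w 0\<bar>"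
    unfolding c_def by linarith
  ultimately have "P / 4 \<le> \<bar>y 0 + h * d 0 + w 0\<bar>"
    using hE P \<epsilon> c by linarith
  then have low: "P / 4 \<le> \<bar>y' 0\<bar>" using y'[of 0] \<mu>(1) by simp
  then show "h * \<bar>a q\<bar> / 4 * \<bar>y 0\<bar> ^ q \<le> \<bar>y' 0\<bar>" by (simp add: P_def \<alpha>_def c_def)
  show "in_cone N ((1 + 32 * real N * L / \<bar>a q\<bar>) * \<rho>) y'"
    unfolding in_cone_def
  proof (intro allI impI)
    fix k assume k: "k \<noteq> 0" "\<bar>k\<bar> \<le> int N"
    have "\<bar>y' k\<bar> \<le> 1 * \<bar>y k + h * d k + w k\<bar>"
      unfolding y'[OF k(2)] abs_mult by (intro mult_right_mono \<mu>) auto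
    also have "\<dots> \<le> \<bar>y k\<bar> + h * \<bar>d k\<bar> + \<bar>w k\<bar>"
      using abs_mult[of h "d k"] h by simp
    also have "\<bar>y k\<bar> \<le> \<rho> * c" using cone k by (auto simp: in_cone_def c_def)
    also have "h * \<bar>d k\<bar> \<le> h * E" using d[of k] k h by (intro mult_left_mono) auto
    also have "\<bar>w k\<bar> \<le> \<rho> * c"
      using w[OF k(2)] \<epsilon> mult_left_mono[OF c \<rho>0] by simp
    also have "\<rho> * c + h * E + \<rho> * c \<le> (1 + 32 * real N * L / \<alpha>) * \<rho> * (P / 4)"
    proof -
      have "(1 + 32 * real N * L / \<alpha>) * \<rho> * (P / 4) = \<rho> * (P / 4) + h * E"
        using \<alpha> by (simp add: P_def E_def field_simps)
      moreover have "\<rho> * c + \<rho> * c \<le> \<rho> * (P / 4)"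
        using mult_left_mono[OF P \<rho>0] mult_nonneg_nonneg[OF \<rho>0, of c] c by simp
      ultimately show ?thesis by linarith
    qed
    also have "\<dots> \<le> (1 + 32 * real N * L / \<alpha>) * \<rho> * \<bar>y' 0\<bar>"
      using low \<rho>0 L \<alpha> by (intro mult_left_mono mult_nonneg_nonneg add_nonneg_nonneg) auto
    finally show "\<bar>y' k\<bar> \<le> (1 + 32 * real N * L / \<bar>a q\<bar>) * \<rho> * \<bar>y' 0\<bar>"
      by (simp add: \<alpha>_def)
  qed
qed

definition spread_factor :: "(nat \<Rightarrow> real) \<Rightarrow> nat \<Rightarrow> real \<Rightarrow> nat \<Rightarrow> real" where
  "spread_factor a q L N = 1 + 32 * real N * L / \<bar>a q\<bar>"

text \<open>Chosen such that after \<open>N\<close> multiplications by the spread factor the width of the cone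
  is \<open>\<bar>a q\<bar> / (64 * L * N)\<close>, the largest width that \<open>cone_step\<close>
  allows.\<close>

definition tolerance :: "(nat \<Rightarrow> real) \<Rightarrow> nat \<Rightarrow> real \<Rightarrow> nat \<Rightarrow> real" where
  "tolerance a q L N = \<bar>a q\<bar> / (64 * L * real N * spread_factor a q L N ^ N)"

text \<open>Above \<open>R\<close> the leading term dominates; the second summand is the height above which a
  step of size \<open>T / N\<close> at least quadruples the state.\<close>

definition start_level :: "real \<Rightarrow> (nat \<Rightarrow> real) \<Rightarrow> nat \<Rightarrow> real \<Rightarrow> nat \<Rightarrow> real" where
  "start_level T a q R N = R + 16 * real N / (T * \<bar>a q\<bar>)"

lemma tolerance_bounds:
  assumes "growth_bounds a q R L" "a q \<noteq> 0" "1 \<le> N"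
  shows "0 < tolerance a q L N" "tolerance a q L N \<le> 1" "1 \<le> spread_factor a q L N"
    "m \<le> N \<Longrightarrow> spread_factor a q L N ^ m * tolerance a q L N \<le> \<bar>a q\<bar> / (64 * L * real N)"
proof -
  have L: "\<bar>a q\<bar> \<le> L" "0 < L" "0 < \<bar>a q\<bar>" using assms by (auto simp: growth_bounds_def)
  have N: "1 \<le> real N" using assms by simp
  show G: "1 \<le> spread_factor a q L N" using L by (simp add: spread_factor_def)
  then have GN: "1 \<le> spread_factor a q L N ^ m" for m by (rule one_le_power)
  have pos: "0 < spread_factor a q L N" using G by linarith
  show t0: "0 < tolerance a q L N" using L N pos by (simp add: tolerance_def)
  show *: "spread_factor a q L N ^ m * tolerance a q L N \<le> \<bar>a q\<bar> / (64 * L * real N)" if "m \<le> N" for m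
  proof -
    have "spread_factor a q L N ^ m * tolerance a q L N \<le> spread_factor a q L N ^ N * tolerance a q L N"
      using t0 by (intro mult_right_mono power_increasing that G) auto
    also have "\<dots> = \<bar>a q\<bar> / (64 * L * real N)" using pos by (simp add: tolerance_def)
    finally show ?thesis .
  qed
  have "\<bar>a q\<bar> * 1 \<le> L * (64 * real N)" using L N by (intro mult_mono) auto
  then have "\<bar>a q\<bar> / (64 * L * real N) \<le> 1" using L N by (simp add: field_simps)
  then show "tolerance a q L N \<le> 1" using *[of 0] by simp
qed

text \<open>With \<open>b = T * \<bar>a q\<bar> / (4 * N)\<close> a step satisfies
  \<open>\<bar>c'\<bar> \<ge> b * \<bar>c\<bar> ^ q \<ge> b * \<bar>c\<bar>\<^sup>2\<close>, so
  \<open>b * \<bar>c\<bar>\<close> is at least squared. It is at least \<open>4\<close> at time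
  \<open>1\<close>. The square bounds every power with \<open>q \<ge> 2\<close> from below since
  \<open>\<bar>c\<bar> \<ge> 1\<close>. The induction starts at time \<open>1\<close>, after the steering
  step.\<close>

lemma doubly_exponential_growth:
  fixes y w :: "nat \<Rightarrow> int \<Rightarrow> real" and \<mu> :: "int \<Rightarrow> real" and a :: "nat \<Rightarrow> real" and q N :: nat
  assumes gb: "growth_bounds a q R L" and q: "2 \<le> q" "a q \<noteq> 0" and T: "0 < T" and N: "1 \<le> N"
    and \<mu>: "\<mu> 0 = 1" "\<And>k. \<bar>\<mu> k\<bar> \<le> 1"
    and start: "\<And>k. \<bar>k\<bar> \<le> int N \<Longrightarrow>
       \<bar>y 1 k - (if k = 0 then start_level T a q R N + 1 else 0)\<bar> \<le> tolerance a q L N"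
    and w: "\<And>n k. 1 \<le> n \<Longrightarrow> n < N \<Longrightarrow> \<bar>k\<bar> \<le> int N \<Longrightarrow> \<bar>w n k\<bar> \<le> tolerance a q L N"
    and step: "\<And>n k. 1 \<le> n \<Longrightarrow> n < N \<Longrightarrow> \<bar>k\<bar> \<le> int N \<Longrightarrow> y (Suc n) k = \<mu> k * (y n k +
       T / real N * inner (ebasis k) (abs_l2 (\<lambda>x. nonlinearity a q (fourier_sum N (y n) x))) + w n k)"
  shows "4 ^ 2 ^ (N - 1) \<le> T * \<bar>a q\<bar> / (4 * real N) * \<bar>y N 0\<bar>"
proof -
  define K \<epsilon> G h b where "K = start_level T a q R N" and "\<epsilon> = tolerance a q L N"
    and "G = spread_factor a q L N" and "h = T / real N" and "b = h * \<bar>a q\<bar> / 4"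
  have \<epsilon>: "0 < \<epsilon>" "\<epsilon> \<le> 1" and G: "1 \<le> G"
    using tolerance_bounds[OF gb q(2) N] by (auto simp: \<epsilon>_def G_def)
  have G\<epsilon>: "G ^ m * \<epsilon> \<le> \<bar>a q\<bar> / (64 * L * real N)" if "m \<le> N" for m
    using tolerance_bounds(4)[OF gb q(2) N that] by (simp add: \<epsilon>_def G_def)
  have L: "\<bar>a q\<bar> \<le> L" "0 < L" and R: "1 \<le> R" using gb q by (auto simp: growth_bounds_def)
  have h: "0 < h" and b: "0 < b" using T N q by (auto simp: h_def b_def)
  have K: "R \<le> K" "1 \<le> K" "4 \<le> b * K"
  proof -
    have "0 \<le> 16 * real N / (T * \<bar>a q\<bar>)" using T by simp
    then show "R \<le> K" "1 \<le> K" using R by (auto simp: K_def start_level_def)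
    have "b * (16 * real N / (T * \<bar>a q\<bar>)) = 4" using T q N by (simp add: b_def h_def field_simps)
    moreover have "0 \<le> b * R" using b R by simp
    ultimately show "4 \<le> b * K" by (simp add: K_def start_level_def distrib_left)
  qed
  \<comment> \<open>The cone has width \<open>\<epsilon>\<close> at time \<open>1\<close>, hence the shift of the index.\<close>
  have "in_cone N (G ^ n * \<epsilon>) (y (Suc n)) \<and> K \<le> \<bar>y (Suc n) 0\<bar> \<and> 4 ^ 2 ^ n \<le> b * \<bar>y (Suc n) 0\<bar>"
    if "n < N" for n
    using that
  proof (induction n)
    case 0
    have s: "\<bar>y 1 0 - (K + 1)\<bar> \<le> \<epsilon>" using start[of 0] by (simp add: K_def \<epsilon>_def)
    then have c: "K \<le> \<bar>y 1 0\<bar>" using \<epsilon> by linarith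
    have "in_cone N \<epsilon> (y 1)"
      unfolding in_cone_def
    proof (intro allI impI)
      fix k :: int assume k: "k \<noteq> 0" "\<bar>k\<bar> \<le> int N"
      then have "\<bar>y 1 k\<bar> \<le> \<epsilon> * 1" using start[of k] by (simp add: \<epsilon>_def)
      also have "\<dots> \<le> \<epsilon> * \<bar>y 1 0\<bar>" using \<epsilon> c K by (intro mult_left_mono) auto
      finally show "\<bar>y 1 k\<bar> \<le> \<epsilon> * \<bar>y 1 0\<bar>" .
    qed
    moreover have "4 \<le> b * \<bar>y 1 0\<bar>"
      using K(3) mult_left_mono[OF c, of b] b by linarith
    ultimately show ?case using c by simp
  next
    case (Suc n)
    define c where "c = \<bar>y (Suc n) 0\<bar>"
    have IH: "in_cone N (G ^ n * \<epsilon>) (y (Suc n))" "K \<le> c" "4 ^ 2 ^ n \<le> b * c"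
      using Suc by (auto simp: c_def)
    have c1: "1 \<le> c" using IH K by linarith
    have bc: "4 \<le> b * c" using K(3) mult_left_mono[OF IH(2), of b] b by linarith
    have cq: "c \<le> c ^ (q - 1)" "c ^ 2 \<le> c ^ q"
      using power_increasing[of 1 "q - 1" c] power_increasing[of 2 q c] q c1 by auto
    have Gn: "1 \<le> G ^ n" by (rule one_le_power[OF G])
    have \<rho>: "\<epsilon> \<le> G ^ n * \<epsilon>" using mult_right_mono[OF Gn, of \<epsilon>] \<epsilon> by simp
    have \<rho>_le: "G ^ n * \<epsilon> \<le> \<bar>a q\<bar> / (64 * L * real N)" using Suc.prems by (intro G\<epsilon>) simp
    have \<rho>2: "8 * real N * L * (G ^ n * \<epsilon>) \<le> \<bar>a q\<bar> / 8"
      using mult_left_mono[OF \<rho>_le, of "8 * real N * L"] L N by simp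
    have "4 * real N * (G ^ n * \<epsilon>) \<le> \<bar>a q\<bar> / (16 * L)"
      using mult_left_mono[OF \<rho>_le, of "4 * real N"] L N by simp
    also have "\<dots> \<le> 1" using L by simp
    finally have \<rho>1: "4 * real N * (G ^ n * \<epsilon>) \<le> 1" .
    have "16 \<le> h * \<bar>a q\<bar> * c" using bc by (simp add: b_def)
    also have "\<dots> \<le> h * \<bar>a q\<bar> * c ^ (q - 1)" using cq h by (intro mult_left_mono) auto
    finally have big: "16 \<le> h * \<bar>a q\<bar> * c ^ (q - 1)" .
    have low: "b * c ^ q \<le> \<bar>y (Suc (Suc n)) 0\<bar>"
      and cone: "in_cone N (G ^ Suc n * \<epsilon>) (y (Suc (Suc n)))"
      using cone_step[OF gb _ q(2) h IH(1) _ \<rho> _ \<rho>1 \<rho>2, of \<mu> "w (Suc n)" "y (Suc (Suc n))"]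
        \<epsilon> q(1) IH(2) K(1) big \<mu> w[of "Suc n"] step[of "Suc n"] Suc.prems
      by (auto simp: c_def b_def h_def G_def \<epsilon>_def spread_factor_def mult.assoc)
    have low2: "b * c ^ 2 \<le> \<bar>y (Suc (Suc n)) 0\<bar>"
      using low mult_left_mono[OF cq(2), of b] b by linarith
    have "K \<le> 1 * c" using IH by simp
    also have "\<dots> \<le> (b * c) * c" using bc c1 by (intro mult_right_mono) auto
    finally have "K \<le> \<bar>y (Suc (Suc n)) 0\<bar>" using low2 by (simp add: power2_eq_square mult.assoc)
    moreover have "4 ^ 2 ^ Suc n \<le> b * \<bar>y (Suc (Suc n)) 0\<bar>"
    proof -
      have "(4::real) ^ 2 ^ Suc n = (4 ^ 2 ^ n)\<^sup>2" by (simp add: power_mult mult.commute flip: power_mult)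
      also have "\<dots> \<le> (b * c)\<^sup>2" by (intro power_mono IH) auto
      also have "\<dots> = b * (b * c ^ 2)" by (simp add: power2_eq_square)
      also have "\<dots> \<le> b * \<bar>y (Suc (Suc n)) 0\<bar>" using low2 b by (intro mult_left_mono) auto
      finally show ?thesis .
    qed
    ultimately show ?case using cone by blast
  qed
  from this[of "N - 1"] show ?thesis using N by (simp add: b_def h_def)
qed

section \<open>Probability that Brownian increments hit prescribed boxes\<close>

text \<open>The interval has length \<open>2 * \<epsilon>\<close>, and it lies within distance \<open>r\<close>
  of the origin, where the density is at least its value at \<open>r\<close>.\<close>

lemma (in prob_space) prob_normal_interval_ge:
  assumes X: "distributed M lborel X (normal_density 0 \<sigma>)" and \<sigma>: "0 < \<sigma>" and \<epsilon>: "0 \<le> \<epsilon>" "\<bar>m\<bar> + \<epsilon> \<le> r"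
  shows "2 * \<epsilon> * (1 / sqrt (2 * pi * \<sigma>\<^sup>2) * exp (- r\<^sup>2 / (2 * \<sigma>\<^sup>2)))
     \<le> prob {\<omega> \<in> space M. \<bar>X \<omega> - m\<bar> \<le> \<epsilon>}"
proof -
  define C where "C = 1 / sqrt (2 * pi * \<sigma>\<^sup>2) * exp (- r\<^sup>2 / (2 * \<sigma>\<^sup>2))"
  have C: "0 \<le> C" by (simp add: C_def)
  let ?A = "{m - \<epsilon>..m + \<epsilon>}"
  have le: "C \<le> normal_density 0 \<sigma> x" if "x \<in> ?A" for x
  proof -
    have "\<bar>x\<bar> \<le> \<bar>r\<bar>" using that \<epsilon> by auto
    then have "x\<^sup>2 \<le> r\<^sup>2" by (simp add: abs_le_square_iff)
    then have "- r\<^sup>2 / (2 * \<sigma>\<^sup>2) \<le> - x\<^sup>2 / (2 * \<sigma>\<^sup>2)"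
      using \<sigma> by (intro divide_right_mono) auto
    then show ?thesis
      unfolding C_def normal_density_def using \<sigma> by (intro mult_left_mono) auto
  qed
  have "ennreal (2 * \<epsilon> * C) = ennreal C * emeasure lborel ?A"
    using \<epsilon> C by (simp add: ennreal_mult' mult.commute flip: ennreal_mult)
  also have "\<dots> = (\<integral>\<^sup>+x. ennreal C * indicator ?A x \<partial>lborel)"
    by (simp add: nn_integral_cmult_indicator)
  also have "\<dots> \<le> (\<integral>\<^sup>+x. ennreal (normal_density 0 \<sigma> x) * indicator ?A x \<partial>lborel)"
    using le by (intro nn_integral_mono) (auto simp: indicator_def intro: ennreal_leI)
  also have "\<dots> = emeasure M (X -` ?A \<inter> space M)"
    by (rule distributed_emeasure[OF X, symmetric]) simp
  also have "X -` ?A \<inter> space M = {\<omega> \<in> space M. \<bar>X \<omega> - m\<bar> \<le> \<epsilon>}" by auto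
  finally show ?thesis
    unfolding emeasure_eq_measure C_def[symmetric] by (simp add: ennreal_le_iff)
qed

lemma (in prob_space) prob_brownian_box_ge:
  assumes B: "brownian_motion M T B" and T: "0 < T" and N: "1 \<le> N"
    and \<epsilon>: "0 \<le> \<epsilon>" "\<And>n. n < N \<Longrightarrow> \<bar>m n\<bar> + \<epsilon> \<le> r"
  shows "(2 * \<epsilon> * (1 / sqrt (2 * pi * (T / real N)) * exp (- r\<^sup>2 / (2 * (T / real N))))) ^ N
     \<le> prob {\<omega> \<in> space M. \<forall>n<N. \<bar>B (real (Suc n) * T / real N) \<omega> - B (real n * T / real N) \<omega> - m n\<bar> \<le> \<epsilon>}"
proof -
  define h where "h = T / real N"
  have h: "0 < h" using T N by (simp add: h_def)
  define t where "t n = real n * T / real N" for n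
  have t: "0 \<le> t n" "t n < t (Suc n)" for n
    using T N by (auto simp: t_def field_simps)
  have tN: "t N = T" using N by (simp add: t_def)
  have tT: "t n \<le> T" if "n \<le> N" for n using that T N by (simp add: t_def field_simps)
  have th: "t (Suc n) - t n = h" for n using N by (simp add: t_def h_def field_simps)
  define X where "X n \<omega> = B (t (Suc n)) \<omega> - B (t n) \<omega>" for n \<omega>
  have ind: "indep_vars (\<lambda>_. borel) X {..<N}"
    using B t(1)[of 0] less_imp_le[OF t(2)] tN unfolding brownian_motion_def X_def by auto
  have dist: "distributed M lborel (X n) (normal_density 0 (sqrt h))" if "n < N" for n
  proof -
    have "0 \<le> t n \<and> t n < t (Suc n) \<and> t (Suc n) \<le> T" using t tT[of "Suc n"] that by auto
    then have "distributed M lborel (\<lambda>\<omega>. B (t (Suc n)) \<omega> - B (t n) \<omega>) (normal_density 0 (sqrt (t (Suc n) - t n)))"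
      using B unfolding brownian_motion_def by blast
    then show ?thesis by (simp add: th X_def[abs_def])
  qed
  let ?c = "2 * \<epsilon> * (1 / sqrt (2 * pi * h) * exp (- r\<^sup>2 / (2 * h)))"
  define A where "A n = {m n - \<epsilon>..m n + \<epsilon>}" for n
  have A: "X n -` A n \<inter> space M = {\<omega> \<in> space M. \<bar>X n \<omega> - m n\<bar> \<le> \<epsilon>}" for n
    by (auto simp: A_def)
  have "?c ^ N = (\<Prod>n<N. ?c)" by simp
  also have "\<dots> \<le> (\<Prod>n<N. prob (X n -` A n \<inter> space M))"
  proof (rule prod_mono, intro conjI)
    fix n assume "n \<in> {..<N}"
    then show "?c \<le> prob (X n -` A n \<inter> space M)"
      using prob_normal_interval_ge[OF dist, of n \<epsilon> "m n" r] \<epsilon> h unfolding A by simp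
  qed (use \<epsilon> h in auto)
  also have "\<dots> = prob (\<Inter>n\<in>{..<N}. X n -` A n \<inter> space M)"
    by (rule indep_varsD_finite[OF ind, symmetric]) (use N in \<open>auto simp: A_def lessThan_empty_iff\<close>)
  also have "(\<Inter>n\<in>{..<N}. X n -` A n \<inter> space M)
      = {\<omega> \<in> space M. \<forall>n<N. \<bar>B (t (Suc n)) \<omega> - B (t n) \<omega> - m n\<bar> \<le> \<epsilon>}"
  proof -
    have "0 \<in> {..<N}" using N by simp
    then show ?thesis unfolding A by (fastforce simp: X_def)
  qed
  finally show ?thesis by (simp only: h_def t_def)
qed

text \<open>Independence is used twice: between the modes, as independence of whole paths, and inside each mode,
  as independence of increments.\<close>

lemma (in prob_space) prob_independent_brownian_boxes_ge:
  fixes \<beta> :: "int \<Rightarrow> real \<Rightarrow> 'a \<Rightarrow> real"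
  assumes B: "\<And>k. brownian_motion M T (\<beta> k)" and T: "0 < T" and N: "1 \<le> N"
    and ind: "indep_vars (\<lambda>_. Pi\<^sub>M {0..T} (\<lambda>_. borel)) (\<lambda>k \<omega>. \<lambda>t\<in>{0..T}. \<beta> k t \<omega>) UNIV"
    and \<epsilon>: "0 \<le> \<epsilon>" "\<And>k n. \<bar>k\<bar> \<le> int N \<Longrightarrow> n < N \<Longrightarrow> \<bar>m k n\<bar> + \<epsilon> \<le> r"
  defines "favourable \<equiv> {\<omega> \<in> space M. \<forall>k. \<bar>k\<bar> \<le> int N \<longrightarrow> (\<forall>n<N.
      \<bar>\<beta> k (real (Suc n) * T / real N) \<omega> - \<beta> k (real n * T / real N) \<omega> - m k n\<bar> \<le> \<epsilon>)}"
  shows "(2 * \<epsilon> * (1 / sqrt (2 * pi * (T / real N)) * exp (- r\<^sup>2 / (2 * (T / real N))))) ^ (N * (2 * N + 1)) \<le> prob favourable"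
    and "favourable \<in> events"
proof -
  define t where "t n = real n * T / real N" for n
  have tT: "t n \<in> {0..T}" if "n \<le> N" for n using that T N by (simp add: t_def field_simps)
  let ?c = "2 * \<epsilon> * (1 / sqrt (2 * pi * (T / real N)) * exp (- r\<^sup>2 / (2 * (T / real N))))"
  let ?P = "Pi\<^sub>M {0..T} (\<lambda>_. borel :: real measure)"
  let ?X = "\<lambda>k \<omega>. \<lambda>t\<in>{0..T}. \<beta> k t \<omega>"
  let ?J = "{- int N..int N}"
  \<comment> \<open>A box is described as a measurable set of paths, to which independence of the paths applies.\<close>
  define A where "A k = {f \<in> space ?P. \<forall>n<N. \<bar>f (t (Suc n)) - f (t n) - m k n\<bar> \<le> \<epsilon>}" for k
  have A: "A k \<in> sets ?P" for k
  proof -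
    have [measurable]: "(\<lambda>f. f (t n)) \<in> borel_measurable ?P" if "n \<le> N" for n
      by (rule measurable_component_singleton[OF tT[OF that]])
    have "{f \<in> space ?P. \<bar>f (t (Suc n)) - f (t n) - m k n\<bar> \<le> \<epsilon>} \<in> sets ?P" if "n < N" for n
    proof -
      have [measurable]: "(\<lambda>f. f (t n)) \<in> borel_measurable ?P" "(\<lambda>f. f (t (Suc n))) \<in> borel_measurable ?P"
        using that by (auto intro!: measurable_component_singleton tT)
      show ?thesis by measurable
    qed
    then have "{f \<in> space ?P. \<forall>n\<in>{..<N}. \<bar>f (t (Suc n)) - f (t n) - m k n\<bar> \<le> \<epsilon>} \<in> sets ?P"
      by (intro sets.sets_Collect_finite_All) auto
    then show ?thesis by (simp add: A_def Ball_def)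
  qed
  have X: "?X k -` A k \<inter> space M = {\<omega> \<in> space M. \<forall>n<N.
      \<bar>\<beta> k (t (Suc n)) \<omega> - \<beta> k (t n) \<omega> - m k n\<bar> \<le> \<epsilon>}" for k
  proof -
    have "?X k \<omega> (t (Suc n)) - ?X k \<omega> (t n) = \<beta> k (t (Suc n)) \<omega> - \<beta> k (t n) \<omega>" if "n < N" for n \<omega>
      using tT[of n] tT[of "Suc n"] that by simp
    moreover have "?X k \<omega> \<in> space ?P" for \<omega> by (simp add: space_PiM)
    ultimately show ?thesis by (auto simp: A_def)
  qed
  have favourable: "favourable = (\<Inter>k\<in>?J. ?X k -` A k \<inter> space M)"
    unfolding X unfolding favourable_def t_def by (auto simp: abs_le_iff)
  have rv: "random_variable ?P (?X k)" for k using ind by (auto simp: indep_vars_def)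
  show "favourable \<in> events"
    unfolding favourable by (intro sets.finite_INT measurable_sets[OF rv A]) auto
  have "?c ^ (N * (2 * N + 1)) = (\<Prod>k\<in>?J. ?c ^ N)"
  proof -
    have "card ?J = 2 * N + 1" by simp
    then show ?thesis by (simp only: prod_constant power_mult)
  qed
  also have "\<dots> \<le> (\<Prod>k\<in>?J. prob (?X k -` A k \<inter> space M))"
  proof (rule prod_mono, intro conjI)
    fix k assume "k \<in> ?J"
    then have "\<bar>m k n\<bar> + \<epsilon> \<le> r" if "n < N" for n using \<epsilon>(2)[of k n] that by (simp add: abs_le_iff)
    then show "?c ^ N \<le> prob (?X k -` A k \<inter> space M)"
      unfolding X t_def by (rule prob_brownian_box_ge[OF B T N \<epsilon>(1)])
  qed (use \<epsilon> T in auto)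
  also have "\<dots> = prob favourable"
    unfolding favourable by (rule indep_varsD[OF ind, symmetric]) (use A in auto)
  finally show "?c ^ (N * (2 * N + 1)) \<le> prob favourable" .
qed

section \<open>Steering the first step\<close>

text \<open>The value of the \<open>n\<close>-th increment of the \<open>k\<close>-th mode around which the
  noise is confined. At time zero it cancels the coefficient produced by the initial value and puts the constant
  function of height \<open>start_level + 1\<close> in its place; the extra \<open>1\<close> absorbs the
  tolerance.\<close>

definition steering :: "real \<Rightarrow> (nat \<Rightarrow> real) \<Rightarrow> nat \<Rightarrow> real \<Rightarrow> nat \<Rightarrow> l2 \<Rightarrow> int \<Rightarrow> nat \<Rightarrow> real" where
  "steering T a q R N \<xi> k n = (if n = 0
     then (if k = 0 then start_level T a q R N + 1 else 0) - (inner (ebasis k) (proj N \<xi>) +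
       T / real N * inner (ebasis k) (abs_l2 (\<lambda>x. nonlinearity a q (fourier_sum N (\<lambda>k. inner (ebasis k) (proj N \<xi>)) x))))
     else 0)"

text \<open>A polynomially bounded upper bound for the steering values plus the tolerance: by crude sup-norm
  estimates, the projected initial value and its image under the nonlinearity grow at most polynomially in
  \<open>N\<close>.\<close>

definition noise_range :: "real \<Rightarrow> (nat \<Rightarrow> real) \<Rightarrow> nat \<Rightarrow> real \<Rightarrow> l2 \<Rightarrow> nat \<Rightarrow> real" where
  "noise_range T a q R \<xi> N = R + 16 * real N / (T * \<bar>a q\<bar>) + 2 + norm \<xi> +
     T * (2 * ((\<Sum>k=0..q. \<bar>a k\<bar>) * (1 + 2 * (2 * real N + 1) * norm \<xi>) ^ q))"

lemma steering_le_noise_range: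
  assumes "growth_bounds a q R L" "a q \<noteq> 0" "0 < T" "1 \<le> N" "\<bar>k\<bar> \<le> int N"
  shows "\<bar>steering T a q R N \<xi> k n\<bar> + tolerance a q L N \<le> noise_range T a q R \<xi> N"
proof -
  define y where "y = (\<lambda>k. inner (ebasis k) (proj N \<xi>))"
  define B where "B = (\<Sum>k=0..q. \<bar>a k\<bar>) * (1 + 2 * (2 * real N + 1) * norm \<xi>) ^ q"
  define d where "d = inner (ebasis k) (abs_l2 (\<lambda>x. nonlinearity a q (fourier_sum N y x)))"
  have B: "0 \<le> B" by (simp add: B_def sum_nonneg)
  have R: "1 \<le> R" using assms by (simp add: growth_bounds_def)
  have s: "0 \<le> 16 * real N / (T * \<bar>a q\<bar>)" using assms by simp
  have y: "\<bar>y j\<bar> \<le> norm \<xi>" if "\<bar>j\<bar> \<le> int N" for j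
    using that by (simp add: y_def inner_ebasis_proj abs_inner_ebasis_le_norm)
  have "\<bar>d\<bar> \<le> 2 * B"
    unfolding d_def
  proof (rule abs_inner_ebasis_le)
    show "trig_poly (\<lambda>x. nonlinearity a q (fourier_sum N y x))"
      by (intro trig_poly_nonlinearity trig_poly_fourier_sum)
    fix x
    have "(1 + \<bar>fourier_sum N y x\<bar>) ^ q \<le> (1 + 2 * (2 * real N + 1) * norm \<xi>) ^ q"
      using abs_fourier_sum_le[OF y] by (intro power_mono add_left_mono) auto
    then have "(\<Sum>k=0..q. \<bar>a k\<bar>) * (1 + \<bar>fourier_sum N y x\<bar>) ^ q \<le> B"
      unfolding B_def by (intro mult_left_mono) (auto intro: sum_nonneg)
    then show "\<bar>nonlinearity a q (fourier_sum N y x)\<bar> \<le> B"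
      using abs_nonlinearity_le[of a q "fourier_sum N y x"] by linarith
  qed
  then have d: "\<bar>T / real N * d\<bar> \<le> T * (2 * B)"
    unfolding abs_mult using assms by (intro mult_mono) (auto simp: field_simps)
  have "\<bar>steering T a q R N \<xi> k n\<bar> \<le> start_level T a q R N + 1 + \<bar>y k\<bar> + \<bar>T / real N * d\<bar>"
  proof -
    define l where "l = (if k = 0 then start_level T a q R N + 1 else 0)"
    have l: "\<bar>l\<bar> \<le> start_level T a q R N + 1" using R s by (simp add: l_def start_level_def)
    have "steering T a q R N \<xi> k n = (if n = 0 then l - (y k + T / real N * d) else 0)"
      by (simp add: steering_def l_def y_def d_def)
    then have "\<bar>steering T a q R N \<xi> k n\<bar> \<le> \<bar>l - (y k + T / real N * d)\<bar>" by auto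
    then show ?thesis using l by linarith
  qed
  then show ?thesis
    using y[OF assms(5)] d tolerance_bounds(2)[OF assms(1,2,4)]
    by (simp add: noise_range_def start_level_def B_def)
qed

text \<open>A pathwise statement: on the favourable event the increments are the steering values up to the
  tolerance, and the norm is at least the modulus of the mean.\<close>

lemma scheme_norm_ge:
  fixes Y :: "nat \<Rightarrow> l2" and w :: "nat \<Rightarrow> 'b::{real_inner,banach}"
  assumes gb: "growth_bounds a q R L" and q: "2 \<le> q" "a q \<noteq> 0" and T: "0 < T" and N: "1 \<le> N"
    and S: "diagonal_smoother \<iota> S \<mu>"
    and init: "Y 0 = proj N \<xi>"
    and rec: "\<And>n. n < N \<Longrightarrow> Y (Suc n) =
       proj N (S (\<iota> (Y n + (T / real N) *\<^sub>R (\<Sum>k=0..q. a k *\<^sub>R l2_power (Y n) k)) + (w (Suc n) - w n)))"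
    and w: "\<And>n. n \<le> N \<Longrightarrow> ((\<lambda>k. b k n *\<^sub>R \<iota> (ebasis k)) has_sum w n) UNIV"
    and fav: "\<And>k n. \<bar>k\<bar> \<le> int N \<Longrightarrow> n < N \<Longrightarrow>
       \<bar>b k (Suc n) - b k n - steering T a q R N \<xi> k n\<bar> \<le> tolerance a q L N"
  shows "4 ^ 2 ^ (N - 1) * (4 / (T * \<bar>a q\<bar>)) \<le> norm (Y N)"
proof -
  define y where "y n k = inner (ebasis k) (Y n)" for n k
  define d where "d n k = inner (ebasis k) (abs_l2 (\<lambda>x. nonlinearity a q (fourier_sum N (y n) x)))" for n k
  have \<mu>: "\<mu> 0 = 1" "\<bar>\<mu> k\<bar> \<le> 1" for k using S by (auto simp: diagonal_smoother_def)
  have YP: "Y n = proj N (Y n)" if "n \<le> N" for n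
  proof (cases n)
    case 0 then show ?thesis by (simp add: init proj_proj)
  next
    case (Suc m) then show ?thesis using rec[of m] that by (simp add: proj_proj)
  qed
  have step: "y (Suc n) k = \<mu> k * (y n k + T / real N * d n k + (b k (Suc n) - b k n))"
    if "n < N" "\<bar>k\<bar> \<le> int N" for n k
    using coefficient_recursion[OF S YP[of n] that(2) w[of n] w[of "Suc n"], of "T / real N" a q] that
    by (simp add: y_def[abs_def] d_def rec)
  have "4 ^ 2 ^ (N - 1) \<le> T * \<bar>a q\<bar> / (4 * real N) * \<bar>y N 0\<bar>"
  proof (rule doubly_exponential_growth[where \<mu> = \<mu> and w = "\<lambda>n k. b k (Suc n) - b k n", OF gb q T N \<mu>])
    fix k :: int assume k: "\<bar>k\<bar> \<le> int N"
    define s where "s = (if k = 0 then start_level T a q R N + 1 else 0)"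
    define e where "e = b k (Suc 0) - b k 0 - steering T a q R N \<xi> k 0"
    have e: "\<bar>e\<bar> \<le> tolerance a q L N" using fav[of k 0] k N by (simp add: e_def)
    have "b k (Suc 0) - b k 0 = s - (y 0 k + T / real N * d 0 k) + e"
      by (simp add: e_def s_def steering_def y_def[abs_def] d_def init)
    then have "y 1 k = \<mu> k * (s + e)" using step[of 0 k] k N by simp
    \<comment> \<open>The target vanishes outside mode zero, where the multiplier is one, so smoothing does not move it.\<close>
    moreover have "\<mu> k * s = s" using \<mu> by (simp add: s_def)
    ultimately have "\<bar>y 1 k - s\<bar> = \<bar>\<mu> k\<bar> * \<bar>e\<bar>" by (simp add: distrib_left abs_mult)
    also have "\<dots> \<le> 1 * \<bar>e\<bar>" by (intro mult_right_mono \<mu>) auto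
    finally show "\<bar>y 1 k - (if k = 0 then start_level T a q R N + 1 else 0)\<bar> \<le> tolerance a q L N"
      using e by (simp add: s_def)
  next
    fix n k assume "1 \<le> n" "n < N" "\<bar>k\<bar> \<le> int N"
    then show "\<bar>b k (Suc n) - b k n\<bar> \<le> tolerance a q L N"
      using fav[of k n] by (simp add: steering_def)
  next
    fix n k assume "1 \<le> n" "n < N" "\<bar>k\<bar> \<le> int N"
    then show "y (Suc n) k = \<mu> k * (y n k + T / real N *
        inner (ebasis k) (abs_l2 (\<lambda>x. nonlinearity a q (fourier_sum N (y n) x))) + (b k (Suc n) - b k n))"
      using step[of n k] by (simp add: d_def)
  qed
  also have "\<dots> \<le> T * \<bar>a q\<bar> / 4 * norm (Y N)"
    unfolding y_def using T N by (intro mult_mono abs_inner_ebasis_le_norm divide_left_mono) auto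
  finally show ?thesis using T q by (simp add: field_simps)
qed

section \<open>The exponent of the hitting probability is polynomial\<close>

lemma exp_dominates_power:
  fixes c k C :: real and d :: nat
  assumes "0 < c"
  shows "filterlim (\<lambda>N::nat. c * 2 ^ N + k - C * real N ^ d) at_top sequentially"
  using assms by real_asymp

text \<open>Polynomial growth of unspecified degree, as a property closed under arithmetic, so that the degree
  of the cost never has to be computed.\<close>

definition poly_bounded :: "(nat \<Rightarrow> real) \<Rightarrow> bool" where
  "poly_bounded f \<longleftrightarrow> (\<exists>C d. \<forall>N\<ge>1. \<bar>f N\<bar> \<le> C * real N ^ d)"

lemma poly_bounded_const: "poly_bounded (\<lambda>N. c)"
  unfolding poly_bounded_def by (rule exI[of _ "\<bar>c\<bar>"], rule exI[of _ 0]) simp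

lemma poly_bounded_real: "poly_bounded real"
  unfolding poly_bounded_def by (rule exI[of _ 1], rule exI[of _ 1]) simp

lemma poly_bounded_mult:
  assumes "poly_bounded f" "poly_bounded g"
  shows "poly_bounded (\<lambda>N. f N * g N)"
proof -
  obtain C d where f: "\<And>N. N \<ge> 1 \<Longrightarrow> \<bar>f N\<bar> \<le> C * real N ^ d" using assms(1) unfolding poly_bounded_def by auto
  obtain D e where g: "\<And>N. N \<ge> 1 \<Longrightarrow> \<bar>g N\<bar> \<le> D * real N ^ e" using assms(2) unfolding poly_bounded_def by auto
  have "\<bar>f N * g N\<bar> \<le> C * D * real N ^ (d + e)" if "N \<ge> 1" for N
    using mult_mono[OF f g, OF that that order_trans[OF abs_ge_zero f[OF that]]]
    by (simp add: abs_mult power_add mult_ac)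
  then show ?thesis unfolding poly_bounded_def by blast
qed

lemma poly_bounded_add:
  assumes "poly_bounded f" "poly_bounded g"
  shows "poly_bounded (\<lambda>N. f N + g N)"
proof -
  obtain C d where f: "\<And>N. N \<ge> 1 \<Longrightarrow> \<bar>f N\<bar> \<le> C * real N ^ d" using assms(1) unfolding poly_bounded_def by auto
  obtain D e where g: "\<And>N. N \<ge> 1 \<Longrightarrow> \<bar>g N\<bar> \<le> D * real N ^ e" using assms(2) unfolding poly_bounded_def by auto
  have CD: "0 \<le> C" "0 \<le> D" using order_trans[OF abs_ge_zero f[of 1]] order_trans[OF abs_ge_zero g[of 1]] by auto
  have "\<bar>f N + g N\<bar> \<le> (C + D) * real N ^ (d + e)" if "N \<ge> 1" for N
  proof -
    have "C * real N ^ d \<le> C * real N ^ (d + e)" "D * real N ^ e \<le> D * real N ^ (d + e)"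
      using that CD by (auto intro!: mult_left_mono power_increasing)
    then show ?thesis using f[OF that] g[OF that] by (simp add: distrib_right)
  qed
  then show ?thesis unfolding poly_bounded_def by blast
qed

lemma poly_bounded_power: "poly_bounded f \<Longrightarrow> poly_bounded (\<lambda>N. f N ^ k)"
  by (induction k) (auto intro: poly_bounded_const poly_bounded_mult)

lemma poly_bounded_divide: "poly_bounded f \<Longrightarrow> poly_bounded (\<lambda>N. f N / c)"
  using poly_bounded_mult[OF _ poly_bounded_const[of "1 / c"]] by simp

lemmas poly_bounded_intros = poly_bounded_const poly_bounded_real poly_bounded_add poly_bounded_mult
  poly_bounded_power poly_bounded_divide

text \<open>The exponent in the lower bound for the probability of confining a single increment of a single
  mode. The first two summands account for the length of the interval (\<open>spread_factor ^ N\<close> is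
  bounded by \<open>exp (N * spread_factor)\<close>), the third for the normalisation of the density, the last
  for its exponential.\<close>

definition cost :: "real \<Rightarrow> (nat \<Rightarrow> real) \<Rightarrow> nat \<Rightarrow> real \<Rightarrow> real \<Rightarrow> l2 \<Rightarrow> nat \<Rightarrow> real" where
  "cost T a q R L \<xi> N = 64 * L * real N / \<bar>a q\<bar> + real N * spread_factor a q L N + pi * T +
     (noise_range T a q R \<xi> N)\<^sup>2 * real N / (2 * T)"

lemma exp_minus_cost_le:
  fixes \<xi> :: l2
  assumes gb: "growth_bounds a q R L" "a q \<noteq> 0" and T: "0 < T" and N: "1 \<le> N"
  defines "r \<equiv> noise_range T a q R \<xi> N"
  shows "exp (- cost T a q R L \<xi> N)
    \<le> 2 * tolerance a q L N * (1 / sqrt (2 * pi * (T / real N)) * exp (- r\<^sup>2 / (2 * (T / real N))))"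
proof -
  have L: "0 < \<bar>a q\<bar>" "0 < L" using gb by (auto simp: growth_bounds_def)
  define G where "G = spread_factor a q L N"
  have G: "1 \<le> G" using tolerance_bounds(3)[OF gb N] by (simp add: G_def)
  define z where "z = 64 * L * real N / \<bar>a q\<bar>"
  have z: "0 < z" using L N by (simp add: z_def)
  have tol: "tolerance a q L N = 1 / (z * G ^ N)" using L by (simp add: tolerance_def z_def G_def)
  have "z \<le> exp z" "G \<le> exp G" using exp_ge_add_one_self[of z] exp_ge_add_one_self[of G] by linarith+
  then have "z * G ^ N \<le> exp z * exp G ^ N"
    using z G by (intro mult_mono power_mono) auto
  also have "\<dots> = exp (z + real N * G)" by (simp add: exp_add exp_of_nat_mult)
  finally have "exp (- (z + real N * G)) \<le> 1 / (z * G ^ N)"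
    unfolding exp_minus inverse_eq_divide using z G by (intro divide_left_mono mult_pos_pos) auto
  also have "\<dots> \<le> 2 * tolerance a q L N"
    unfolding tol[symmetric] using tolerance_bounds(1)[OF gb N] by linarith
  finally have 1: "exp (- (z + real N * G)) \<le> 2 * tolerance a q L N" .
  have h: "0 < T / real N" "T / real N \<le> T" using T N by (auto simp: field_simps)
  define u where "u = 2 * pi * (T / real N)"
  have u: "0 < u" unfolding u_def by (intro mult_pos_pos h) auto
  have "u \<le> exp u" using exp_ge_add_one_self[of u] by linarith
  also have "\<dots> \<le> exp (2 * (pi * T))" using mult_left_mono[OF h(2), of "2 * pi"] by (simp add: u_def)
  also have "\<dots> = (exp (pi * T))\<^sup>2" by (simp add: exp_double)
  finally have "sqrt u \<le> exp (pi * T)" by (intro real_le_lsqrt) (use u in auto)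
  then have 2: "exp (- (pi * T)) \<le> 1 / sqrt u"
    unfolding exp_minus inverse_eq_divide using u by (intro divide_left_mono mult_pos_pos) auto
  have 3: "exp (- (r\<^sup>2 * real N / (2 * T))) = exp (- r\<^sup>2 / (2 * (T / real N)))"
    using T N by (simp add: field_simps)
  have "exp (- cost T a q R L \<xi> N) =
      exp (- (z + real N * G)) * (exp (- (pi * T)) * exp (- (r\<^sup>2 * real N / (2 * T))))"
    unfolding exp_add[symmetric] by (simp add: cost_def z_def G_def r_def)
  also have "\<dots> \<le> 2 * tolerance a q L N * (1 / sqrt u * exp (- (r\<^sup>2 * real N / (2 * T))))"
    by (intro mult_mono 1 2) (use tolerance_bounds(1)[OF gb N] u in auto)
  finally show ?thesis by (simp only: 3 u_def)
qed

lemma poly_bounded_cost: "poly_bounded (cost T a q R L \<xi>)"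
  unfolding cost_def[abs_def] noise_range_def spread_factor_def by (intro poly_bounded_intros)

section \<open>Divergence of the moments\<close>

text \<open>Chebyshev's argument: the moment is at least the \<open>p\<close>-th power of the height reached on
  the favourable event times the probability of this event, which is a product over
  \<open>N * (2 * N + 1)\<close> increments. The noise series converges at all \<open>N + 1\<close> grid points
  simultaneously outside a null set.\<close>

lemma (in prob_space) moment_ge:
  fixes Y :: "nat \<Rightarrow> 'a \<Rightarrow> l2" and \<iota> :: "l2 \<Rightarrow> 'b::{real_inner,banach}"
  assumes gb: "growth_bounds a q R L" and q: "2 \<le> q" "a q \<noteq> 0" and T: "0 < T" and N: "1 \<le> N" and p: "0 < p"
    and S: "diagonal_smoother \<iota> S \<mu>"
    and W: "cylindrical_wiener M T \<iota> W"
    and init: "\<And>\<omega>. \<omega> \<in> space M \<Longrightarrow> Y 0 \<omega> = proj N \<xi>"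
    and rec: "\<And>n \<omega>. n < N \<Longrightarrow> \<omega> \<in> space M \<Longrightarrow> Y (Suc n) \<omega> =
       proj N (S (\<iota> (Y n \<omega> + (T / real N) *\<^sub>R (\<Sum>k=0..q. a k *\<^sub>R l2_power (Y n \<omega>) k))
         + (W (real (Suc n) * T / real N) \<omega> - W (real n * T / real N) \<omega>)))"
  shows "ennreal (exp (p * (ln 4 * 2 ^ (N - 1) + ln (4 / (T * \<bar>a q\<bar>))) - cost T a q R L \<xi> N * (real N * (2 * real N + 1))))
     \<le> (\<integral>\<^sup>+ \<omega>. ennreal (norm (Y N \<omega>) powr p) \<partial>M)"
proof -
  obtain \<beta> where \<beta>: "\<And>k. brownian_motion M T (\<beta> k)"
      "indep_vars (\<lambda>_. Pi\<^sub>M {0..T} (\<lambda>_. borel)) (\<lambda>k \<omega>. \<lambda>t\<in>{0..T}. \<beta> k t \<omega>) UNIV"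
      "\<And>t. t \<in> {0..T} \<Longrightarrow> AE \<omega> in M. ((\<lambda>n. \<beta> n t \<omega> *\<^sub>R \<iota> (ebasis n)) has_sum W t \<omega>) UNIV"
    using W unfolding cylindrical_wiener_def by blast
  define t where "t n = real n * T / real N" for n
  define E where "E = {\<omega> \<in> space M. \<forall>k. \<bar>k\<bar> \<le> int N \<longrightarrow> (\<forall>n<N.
      \<bar>\<beta> k (t (Suc n)) \<omega> - \<beta> k (t n) \<omega> - steering T a q R N \<xi> k n\<bar> \<le> tolerance a q L N)}"
  define X where "X = 4 ^ 2 ^ (N - 1) * (4 / (T * \<bar>a q\<bar>))"
  define Q where "Q = cost T a q R L \<xi> N * (real N * (2 * real N + 1))"
  have X: "0 < X" using T q by (simp add: X_def)
  note box = prob_independent_brownian_boxes_ge[OF \<beta>(1) T N \<beta>(2), of "tolerance a q L N" "steering T a q R N \<xi>"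
      "noise_range T a q R \<xi> N", folded t_def, folded E_def]
  have tol: "0 \<le> tolerance a q L N" using tolerance_bounds(1)[OF gb q(2) N] by simp
  have E: "E \<in> events" using box(2) tol steering_le_noise_range[OF gb q(2) T N] by blast
  have "exp (- Q) = exp (- cost T a q R L \<xi> N) ^ (N * (2 * N + 1))"
    unfolding exp_of_nat_mult[symmetric] Q_def by (simp add: algebra_simps)
  also have "\<dots> \<le> prob E"
    using power_mono[OF exp_minus_cost_le[OF gb q(2) T N, of \<xi>], of "N * (2 * N + 1)"]
      box(1)[OF tol steering_le_noise_range[OF gb q(2) T N]] by simp
  finally have PE: "exp (- Q) \<le> prob E" .
  have "AE \<omega> in M. \<forall>n\<in>{..N}. ((\<lambda>k. \<beta> k (t n) \<omega> *\<^sub>R \<iota> (ebasis k)) has_sum W (t n) \<omega>) UNIV"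
    using T N by (intro AE_finite_allI \<beta>(3)) (auto simp: t_def field_simps)
  then have ae: "AE \<omega> in M. ennreal (X powr p) * indicator E \<omega> \<le> ennreal (norm (Y N \<omega>) powr p)"
  proof (eventually_elim)
    case (elim \<omega>)
    show ?case
    proof (cases "\<omega> \<in> E")
      case True
      then have "\<omega> \<in> space M" by (simp add: E_def)
      have "X \<le> norm (Y N \<omega>)"
        unfolding X_def
      proof (rule scheme_norm_ge[OF gb q T N S, where Y = "\<lambda>n. Y n \<omega>" and w = "\<lambda>n. W (t n) \<omega>" and b = "\<lambda>k n. \<beta> k (t n) \<omega>"])
        show "Y 0 \<omega> = proj N \<xi>" by (rule init[OF \<open>\<omega> \<in> space M\<close>])
      next
        fix n assume "n < N"
        from rec[OF this \<open>\<omega> \<in> space M\<close>] show "Y (Suc n) \<omega> =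
          proj N (S (\<iota> (Y n \<omega> + (T / real N) *\<^sub>R (\<Sum>k=0..q. a k *\<^sub>R l2_power (Y n \<omega>) k)) + (W (t (Suc n)) \<omega> - W (t n) \<omega>)))"
          by (simp only: t_def)
      qed (use elim True in \<open>auto simp: E_def\<close>)
      then have "X powr p \<le> norm (Y N \<omega>) powr p" using X p by (intro powr_mono2) auto
      then show ?thesis using True by (simp add: ennreal_leI)
    qed simp
  qed
  have "X = exp (ln 4 * 2 ^ (N - 1) + ln (4 / (T * \<bar>a q\<bar>)))"
  proof -
    have "(4::real) ^ 2 ^ (N - 1) = exp (ln 4) ^ 2 ^ (N - 1)" by simp
    also have "\<dots> = exp (ln 4 * 2 ^ (N - 1))"
      using exp_of_nat_mult[of "2 ^ (N - 1)" "ln 4 :: real"] by (simp add: mult.commute)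
    finally show ?thesis using T q by (simp add: X_def exp_add)
  qed
  then have Xp: "X powr p = exp (p * (ln 4 * 2 ^ (N - 1) + ln (4 / (T * \<bar>a q\<bar>))))"
    by (simp add: powr_def)
  have "exp (p * (ln 4 * 2 ^ (N - 1) + ln (4 / (T * \<bar>a q\<bar>))) - Q) = X powr p * exp (- Q)"
    by (simp add: Xp exp_diff exp_minus field_simps)
  also have "\<dots> \<le> X powr p * prob E" by (intro mult_left_mono PE) auto
  finally have "ennreal (exp (p * (ln 4 * 2 ^ (N - 1) + ln (4 / (T * \<bar>a q\<bar>))) - Q)) \<le> ennreal (X powr p * prob E)"
    by (rule ennreal_leI)
  also have "\<dots> = (\<integral>\<^sup>+ \<omega>. ennreal (X powr p) * indicator E \<omega> \<partial>M)"
    using E by (simp add: nn_integral_cmult_indicator emeasure_eq_measure ennreal_mult')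
  also have "\<dots> \<le> (\<integral>\<^sup>+ \<omega>. ennreal (norm (Y N \<omega>) powr p) \<partial>M)"
    by (rule nn_integral_mono_AE[OF ae])
  finally show ?thesis by (simp only: Q_def)
qed

theorem theorem1p2:
  fixes M :: "'w measure"
    and T \<eta> \<nu> :: real
    and q :: nat
    and a :: "nat \<Rightarrow> real"
    and \<iota> :: "l2 \<Rightarrow> 'b::{real_inner,banach}"
    and \<xi> :: l2
    and W :: "real \<Rightarrow> 'w \<Rightarrow> 'b"
    and S :: "nat \<Rightarrow> 'b \<Rightarrow> l2"
    and Y :: "nat \<Rightarrow> nat \<Rightarrow> 'w \<Rightarrow> l2"
  assumes "prob_space M"
    and "0 < T" and "0 < \<eta>"
    and "2 \<le> q" and "a q \<noteq> 0"
    and "1/4 < \<nu>" and "\<nu> < 3/4"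
    and "neg_interpolation_space \<eta> (- \<nu>) \<iota>"
    and "\<xi> \<in> frac_dom \<eta> (1/3)"
    and "cylindrical_wiener M T \<iota> W"
    and "\<And>N. 1 \<le> N \<Longrightarrow>
           continuous_extension \<iota> (heat (T / real N)) (S N) \<or>
           continuous_extension \<iota> (resolvent (T / real N)) (S N)"
    and "\<And>N n. 1 \<le> N \<Longrightarrow> n \<le> N \<Longrightarrow> Y N n \<in> borel_measurable M"
    and "\<And>N \<omega>. 1 \<le> N \<Longrightarrow> \<omega> \<in> space M \<Longrightarrow> Y N 0 \<omega> = proj N \<xi>"
    and "\<And>N n \<omega>. 1 \<le> N \<Longrightarrow> n < N \<Longrightarrow> \<omega> \<in> space M \<Longrightarrow>
           Y N (Suc n) \<omega> =
             proj N (S N (\<iota> (Y N n \<omega> + (T / real N) *\<^sub>R (\<Sum>k=0..q. a k *\<^sub>R l2_power (Y N n \<omega>) k))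
               + (W (real (Suc n) * T / real N) \<omega> - W (real n * T / real N) \<omega>)))"
  shows "\<forall>p>0. liminf (\<lambda>N. \<integral>\<^sup>+ \<omega>. ennreal (norm (Y N N \<omega>) powr p) \<partial>M) = \<infinity>"
proof (intro allI impI)
  fix p :: real assume p: "0 < p"
  interpret prob_space M by fact
  obtain R L where gb: "growth_bounds a q R L"
    using growth_bounds_exist[of q a] assms(4,5) by auto
  define I where "I N = (\<integral>\<^sup>+ \<omega>. ennreal (norm (Y N N \<omega>) powr p) \<partial>M)" for N
  define \<kappa> where "\<kappa> = ln (4 / (T * \<bar>a q\<bar>))"
  define Q where "Q N = cost T a q R L \<xi> N * (real N * (2 * real N + 1))" for N
  have lower: "ennreal (exp (p * (ln 4 * 2 ^ (N - 1) + \<kappa>) - Q N)) \<le> I N" if N: "1 \<le> N" for N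
  proof -
    have "linear \<iota>" using assms(8) by (simp add: neg_interpolation_space_def)
    moreover have "0 \<le> T / real N" using assms(2) by simp
    ultimately obtain \<mu> where S: "diagonal_smoother \<iota> (S N) \<mu>"
      using diagonal_smoother_exists assms(11)[OF N] by blast
    show ?thesis
      unfolding I_def \<kappa>_def Q_def
      by (rule moment_ge[where Y = "Y N", OF gb assms(4,5,2) N p S assms(10) assms(13)[OF N] assms(14)[OF N]])
  qed
  have "poly_bounded Q"
    unfolding Q_def[abs_def] by (intro poly_bounded_intros poly_bounded_cost)
  then obtain C d where Q: "\<And>N. 1 \<le> N \<Longrightarrow> \<bar>Q N\<bar> \<le> C * real N ^ d"
    unfolding poly_bounded_def by auto
  have "filterlim (\<lambda>N. p * ln 4 / 2 * 2 ^ N + p * \<kappa> - C * real N ^ d) at_top sequentially"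
    using p by (intro exp_dominates_power) simp
  then have "filterlim (\<lambda>N. p * (ln 4 * 2 ^ (N - 1) + \<kappa>) - Q N) at_top sequentially"
  proof (rule filterlim_at_top_mono)
    show "\<forall>\<^sub>F N in sequentially. p * ln 4 / 2 * 2 ^ N + p * \<kappa> - C * real N ^ d
        \<le> p * (ln 4 * 2 ^ (N - 1) + \<kappa>) - Q N"
      using eventually_ge_at_top[of 1]
    proof eventually_elim
      case (elim N)
      then have "(2::real) ^ N = 2 * 2 ^ (N - 1)" by (cases N) auto
      then show ?case using Q[OF elim] by (simp add: algebra_simps)
    qed
  qed
  then have "filterlim (\<lambda>N. exp (p * (ln 4 * 2 ^ (N - 1) + \<kappa>) - Q N)) at_top sequentially"
    by (rule filterlim_compose[OF exp_at_top])
  then have "((\<lambda>N. ennreal (exp (p * (ln 4 * 2 ^ (N - 1) + \<kappa>) - Q N))) \<longlongrightarrow> top) sequentially"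
    by (simp add: ennreal_tendsto_top_eq_at_top)
  then have "liminf (\<lambda>N. ennreal (exp (p * (ln 4 * 2 ^ (N - 1) + \<kappa>) - Q N))) = top"
    by (intro lim_imp_Liminf) auto
  moreover have "liminf (\<lambda>N. ennreal (exp (p * (ln 4 * 2 ^ (N - 1) + \<kappa>) - Q N))) \<le> liminf I"
    by (intro Liminf_mono eventually_mono[OF eventually_ge_at_top[of 1] lower])
  ultimately have "liminf I = top" by (simp add: top_unique)
  then show "liminf (\<lambda>N. \<integral>\<^sup>+ \<omega>. ennreal (norm (Y N N \<omega>) powr p) \<partial>M) = \<infinity>"
    unfolding I_def[abs_def] by simp
qed

end
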